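(* Let $M$ be a matrix dilation of the form $\begin{pmatrix}\gamma_1&0\\0&\gamma_2\end{pmatrix}$ or $\begin{pmatrix}0&\gamma_1\\\gamma_2&0\end{pmatrix}$ with $\gamma_1,\gamma_2\in\mathbb Z$, let $m=|\det M|=|\gamma_1\gamma_2|$, $n\in\mathbb N$ and $c=(1/2,1/2)$. Let masks $m_0$ and $\widetilde m_0$ be axial symmetric with respect to the center $c$, let $m_0$ have sum rule of order $n$ (with respect to $M$), and let $\widetilde m_0$ satisfy $$D^\beta\big(1-m_0(\xi)\overline{\widetilde m_0(\xi)}\big)\Big|_{\xi=\mathbf 0}=0\qquad\forall\beta\in\Delta_n.$$ Then there exist wavelet masks $m_\nu$ and $\widetilde m_\nu$, $\nu=1,\dots,m$ (for $m_0,\widetilde m_0$), each of which is axial symmetric or axial antisymmetric with respect to some center, and such that the masks $\widetilde m_\nu$, $\nu=1,\dots,m$, have vanishing moments of order $n$.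
   Context: A matrix dilation $M$ is an integer matrix all of whose eigenvalues are bigger than 1 in modulus; $M^*$ is its conjugate (transpose). A set of digits $D(M)=\{s_0,\dots,s_{m-1}\}$ contains exactly one representative of each coset of $\mathbb Z^2/M\mathbb Z^2$. $\Delta_n=\{\alpha\in\mathbb Z^2_+:\alpha_1+\alpha_2<n\}$. A trigonometric polynomial is a finite sum $t(\xi)=\sum_{k\in\mathbb Z^2}h_ke^{2\pi i(k,\xi)}$, $h_k\in\mathbb C$; a mask (refinable mask) is a trigonometric polynomial equal to 1 at $\mathbf 0$. The polyphase components $\tau_k$, $k=0,\dots,m-1$, of $t$ are the unique trigonometric polynomials with $t(\xi)=\frac1{\sqrt m}\sum_{k=0}^{m-1}e^{2\pi i(s_k,\xi)}\tau_k(M^*\xi)$. The axial symmetry group is $G^{axis}=\{\pm I_2,\pm Y\}$, $Y=\begin{pmatrix}-1&0\\0&1\end{pmatrix}$. $t$ is axial symmetric with respect to a center $c\in\frac12\mathbb Z^2$ if $t(\xi)=e^{2\pi i(c-Ec,\xi)}t(E^*\xi)$ for all $E\in G^{axis}$; $t$ is axial antisymmetric with respect to the center $c$ if for every $E\in G^{axis}$, $t(\xi)=\pm e^{2\pi i(c-Ec,\xi)}t(E^*\xi)$ with a sign that may depend on $E$. $t$ has sum rule of order $n$ with respect to $M$ if $D^\beta(t(M^{*-1}\xi))|_{\xi=s}=0$ for all $s\in D(M^* )\setminus\{\mathbf 0\}$, $\beta\in\Delta_n$ (where $\mathbf 0\in D(M^* )$). $t$ has vanishing moments of order $n$ if $D^\beta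 t(\mathbf 0)=0$ for all $\beta\in\Delta_n$. Wavelet masks: given masks $m_0,\widetilde m_0$, trigonometric polynomials $m_\nu,\widetilde m_\nu$, $\nu=1,\dots,m$, are called wavelet masks for $m_0,\widetilde m_0$ if the $(m+1)\times m$ matrices $\mathcal M=(\mu_{\nu k})$, $\widetilde{\mathcal M}=(\widetilde\mu_{\nu k})$, $\nu=0,\dots,m$, $k=0,\dots,m-1$, where $\mu_{\nu k}$, $\widetilde\mu_{\nu k}$ are the polyphase components of $m_\nu$, $\widetilde m_\nu$, satisfy $\mathcal M^T\overline{\widetilde{\mathcal M}}=I_m$ (mixed extension principle). *)

theory Defs
  imports "HOL-Analysis.Analysis"
begin

section \<open>Lattice, dilations and digits\<close>

abbreviation lat :: "int^2 \<Rightarrow> real^2"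
  where "lat k \<equiv> (\<chi> i. of_int (k $ i))"

definition matrix_dilation :: "int^2^2 \<Rightarrow> bool"
  where "matrix_dilation M \<longleftrightarrow>
    (\<forall>(\<mu>::complex) v. v \<noteq> 0 \<and> map_matrix of_int M *v v = \<mu> *s v \<longrightarrow> cmod \<mu> > 1)"

definition digit_set :: "int^2^2 \<Rightarrow> (int^2) set \<Rightarrow> bool"
  where "digit_set M D \<longleftrightarrow> (\<forall>x. \<exists>!d. d \<in> D \<and> x - d \<in> range (\<lambda>z. M *v z))"

definition index :: "int^2^2 \<Rightarrow> nat"
  where "index M = nat \<bar>det M\<bar>"

definition digit_enumeration :: "int^2^2 \<Rightarrow> (nat \<Rightarrow> int^2) \<Rightarrow> bool"
  where "digit_enumeration M s \<longleftrightarrow>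
    inj_on s {..<index M} \<and> digit_set M (s ` {..<index M})"

section \<open>Trigonometric polynomials and partial derivatives\<close>

definition character :: "real^2 \<Rightarrow> real^2 \<Rightarrow> complex"
  where "character x \<xi> = exp (2 * of_real pi * \<i> * of_real (x \<bullet> \<xi>))"

definition trig_poly :: "(real^2 \<Rightarrow> complex) \<Rightarrow> bool"
  where "trig_poly t \<longleftrightarrow>
    (\<exists>K h. finite K \<and> t = (\<lambda>\<xi>. \<Sum>k\<in>K. h k * character (lat k) \<xi>))"

definition refinable_mask :: "(real^2 \<Rightarrow> complex) \<Rightarrow> bool"
  where "refinable_mask t \<longleftrightarrow> trig_poly t \<and> t 0 = 1"

definition partial_derivative :: "2 \<Rightarrow> (real^2 \<Rightarrow> complex) \<Rightarrow> real^2 \<Rightarrow> complex"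
  where "partial_derivative i f x = vector_derivative (\<lambda>r. f (x + r *\<^sub>R axis i 1)) (at 0)"

text \<open>All functions to which this is applied are smooth, so the order in which
  the partial derivatives are taken is immaterial.\<close>

definition multi_derivative :: "nat^2 \<Rightarrow> (real^2 \<Rightarrow> complex) \<Rightarrow> real^2 \<Rightarrow> complex"
  where "multi_derivative \<beta> f =
    (partial_derivative 1 ^^ (\<beta> $ 1)) ((partial_derivative 2 ^^ (\<beta> $ 2)) f)"

definition Delta :: "nat \<Rightarrow> (nat^2) set"
  where "Delta n = {\<alpha>. \<alpha> $ 1 + \<alpha> $ 2 < n}"

text \<open>\<open>D\<close> is meant to be a digit set of \<open>transpose M\<close> containing \<open>0\<close>.\<close>

definition sum_rule ::
    "int^2^2 \<Rightarrow> (int^2) set \<Rightarrow> nat \<Rightarrow> (real^2 \<Rightarrow> complex) \<Rightarrow> bool"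
  where "sum_rule M D n t \<longleftrightarrow>
    (\<forall>s \<in> D - {0}. \<forall>\<beta> \<in> Delta n.
      multi_derivative \<beta>
        (\<lambda>\<xi>. t (matrix_inv (map_matrix of_int (transpose M)) *v \<xi>)) (lat s) = 0)"

definition vanishing_moments :: "nat \<Rightarrow> (real^2 \<Rightarrow> complex) \<Rightarrow> bool"
  where "vanishing_moments n t \<longleftrightarrow> (\<forall>\<beta> \<in> Delta n. multi_derivative \<beta> t 0 = 0)"

section \<open>Axial symmetry\<close>

definition G_axis :: "(real^2^2) set"
  where "G_axis =
    (let Y = vector [vector [-1, 0], vector [0, 1]] in {mat 1, - mat 1, Y, - Y})"

definition half_lattice :: "(real^2) set"
  where "half_lattice = range (\<lambda>k. (1/2) *\<^sub>R lat k)"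

definition axial_symmetric :: "real^2 \<Rightarrow> (real^2 \<Rightarrow> complex) \<Rightarrow> bool"
  where "axial_symmetric c t \<longleftrightarrow> c \<in> half_lattice \<and>
    (\<forall>E \<in> G_axis. \<forall>\<xi>. t \<xi> = character (c - E *v c) \<xi> * t (transpose E *v \<xi>))"

definition axial_antisymmetric :: "real^2 \<Rightarrow> (real^2 \<Rightarrow> complex) \<Rightarrow> bool"
  where "axial_antisymmetric c t \<longleftrightarrow> c \<in> half_lattice \<and>
    (\<forall>E \<in> G_axis. \<exists>\<epsilon> \<in> {1, -1}.
      \<forall>\<xi>. t \<xi> = \<epsilon> * character (c - E *v c) \<xi> * t (transpose E *v \<xi>))"

section \<open>Polyphase components and wavelet masks\<close>

definition polyphase_components ::
    "int^2^2 \<Rightarrow> (nat \<Rightarrow> int^2) \<Rightarrow> (real^2 \<Rightarrow> complex) \<Rightarrow> (nat \<Rightarrow> real^2 \<Rightarrow> complex) \<Rightarrow> bool"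
  where "polyphase_components M s t \<tau> \<longleftrightarrow>
    (\<forall>k < index M. trig_poly (\<tau> k)) \<and>
    (\<forall>\<xi>. t \<xi> = 1 / of_real (sqrt (real (index M))) *
      (\<Sum>k<index M. character (lat (s k)) \<xi> * \<tau> k (map_matrix of_int (transpose M) *v \<xi>)))"

text \<open>The families \<open>f\<close> and \<open>f'\<close> consist of the given masks at \<open>0\<close> and the wavelet
  masks at \<open>1, \<dots>, m\<close>.  The polyphase components at indices below \<open>m\<close> are uniquely
  determined, so it does not matter that they are introduced existentially.  The last
  conjunct is the entrywise form of \<open>A\<^sup>T B = I\<close>, with \<open>A = (\<mu> \<nu> k)\<close>
  and \<open>B\<close> the complex conjugate of \<open>(\<mu>' \<nu> k)\<close>.\<close>

definition wavelet_masks ::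
    "int^2^2 \<Rightarrow> (nat \<Rightarrow> int^2) \<Rightarrow> (nat \<Rightarrow> real^2 \<Rightarrow> complex) \<Rightarrow> (nat \<Rightarrow> real^2 \<Rightarrow> complex) \<Rightarrow> bool"
  where "wavelet_masks M s f f' \<longleftrightarrow>
    (\<forall>\<nu> \<le> index M. trig_poly (f \<nu>) \<and> trig_poly (f' \<nu>)) \<and>
    (\<exists>\<mu> \<mu>'.
      (\<forall>\<nu> \<le> index M. polyphase_components M s (f \<nu>) (\<mu> \<nu>) \<and>
                      polyphase_components M s (f' \<nu>) (\<mu>' \<nu>)) \<and>
      (\<forall>j < index M. \<forall>k < index M. \<forall>\<xi>.
        (\<Sum>\<nu>\<le>index M. \<mu> \<nu> j \<xi> * cnj (\<mu>' \<nu> k \<xi>)) = (if j = k then 1 else 0)))"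

end

theory Submission
  imports Defs
begin

text \<open>
  Write \<open>e\<^sub>d\<close> for the character with frequency \<open>d\<close> and let \<open>p\<^sub>d\<close> be the coset part of \<open>m0\<close>, the sum of
  its terms with frequency in \<open>d + M \<int>\<^sup>2\<close>.  The coset parts encode the polyphase components:
  \<open>e\<^sub>d(\<xi>) \<mu>\<^sub>d(M\<^sup>T \<xi>) = \<surd>m p\<^sub>d(\<xi>)\<close>.

  Without the symmetry requirement a solution can be written down at once.  For each digit \<open>d\<close>
  take \<open>e\<^sub>d / \<surd>m\<close> as a wavelet mask and \<open>e\<^sub>d (1 - m cnj(p\<^sub>d) m0') / \<surd>m\<close> as its dual.  The first
  family has the identity as its polyphase matrix, the conjugate of the second has
  \<open>I - \<mu>\<^sup>T cnj(\<mu>')\<close> (with \<open>\<mu>\<close>, \<open>\<mu>'\<close> the polyphase rows of \<open>m0\<close>, \<open>m0'\<close>), and the mixed extension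
  principle asks just for this.  The vanishing moments come from the sum rule.  Fourier inversion
  on the finite group \<open>\<int>\<^sup>2 / M\<^sup>T \<int>\<^sup>2\<close> writes \<open>m p\<^sub>d\<close> as a sum of modulated translates of \<open>m0\<close> by the
  points of the dual lattice; by the sum rule all of them except \<open>m0\<close> itself vanish to order \<open>n\<close>
  at the origin (lemma \<open>coset_part_vanishing_moments\<close>).  Hence \<open>1 - m cnj(p\<^sub>d) m0'\<close> agrees to
  order \<open>n\<close> with \<open>1 - cnj(m0) m0'\<close>, which vanishes to order \<open>n\<close> by hypothesis.

  Both properties survive when the two families are mixed by one constant real orthogonal matrix
  \<open>V\<close> (lemma \<open>mixed_extension\<close>), and \<open>V\<close> can be chosen to restore the symmetry.  For both shapes
  of \<open>M\<close> the lattice \<open>M \<int>\<^sup>2\<close> equals \<open>\<gamma>1 \<int> \<times> \<gamma>2 \<int>\<close>, and the symmetry of \<open>m0\<close> about \<open>(1/2, 1/2)\<close>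
  makes the reflections \<open>x \<mapsto> 1 - x\<close> of the two coordinates permute the coset parts.  So it suffices
  to work in one coordinate, modulo \<open>q = \<bar>\<gamma>\<bar>\<close>, and to take tensor products.  The digits are chosen
  such that \<open>x \<mapsto> 1 - x\<close> exchanges them in pairs; on a pair \<open>V\<close> takes normalised sums and differences,
  which are symmetric and antisymmetric about \<open>1/2\<close>.  If \<open>q\<close> is odd, one residue class is mapped to
  itself; its digit \<open>(q + 1) / 2\<close> stays alone and becomes the centre of symmetry in that
  coordinate (lemma \<open>axial_antisymmetric_butterfly\<close>).
\<close>

section \<open>Characters and trigonometric polynomials\<close>

lemma character_add: "character (x + y) \<xi> = character x \<xi> * character y \<xi>"
  by (simp add: character_def inner_add_left distrib_left exp_add)

lemma character_zero [simp]: "character 0 \<xi> = 1" "character x 0 = 1"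
  by (simp_all add: character_def)

lemma cnj_character: "cnj (character x \<xi>) = character (- x) \<xi>"
  by (simp add: character_def exp_cnj)

lemma character_mult_cnj: "character x \<xi> * cnj (character x \<xi>) = 1"
  by (simp add: cnj_character character_add[symmetric])

lemma character_lat_mult:
  "character (lat (M *v z)) \<xi> = character (lat z) (map_matrix of_int (transpose M) *v \<xi>)"
proof -
  have "lat (M *v z) = map_matrix of_int M *v lat z"
    by (simp add: vec_eq_iff matrix_vector_mult_def map_matrix_def)
  moreover have "map_matrix of_int (transpose M) = (transpose (map_matrix of_int M) :: real^2^2)"
    by (simp add: vec_eq_iff transpose_def map_matrix_def)
  ultimately show ?thesis
    using dot_lmul_matrix[of \<xi> "map_matrix of_int M :: real^2^2" "lat z"]
    by (simp add: character_def inner_commute[of "_ *v _"] inner_commute[of "lat z"])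
qed

lemma trig_poly_monomial: "trig_poly (\<lambda>\<xi>. a * character (lat k) \<xi>)"
  unfolding trig_poly_def by (rule exI[of _ "{k}"], rule exI[of _ "\<lambda>_. a"]) auto

lemma trig_poly_character: "trig_poly (character (lat k))"
  using trig_poly_monomial[of 1 k] by simp

lemma trig_poly_const: "trig_poly (\<lambda>\<xi>. a)"
proof -
  have "lat 0 = 0" by (simp add: vec_eq_iff)
  with trig_poly_monomial[of a 0] show ?thesis by simp
qed

lemma trig_poly_common_support:
  assumes "trig_poly t" "trig_poly u"
  obtains K h g where "finite K"
    "t = (\<lambda>\<xi>. \<Sum>k\<in>K. h k * character (lat k) \<xi>)"
    "u = (\<lambda>\<xi>. \<Sum>k\<in>K. g k * character (lat k) \<xi>)"
proof -
  obtain K h L g where K: "finite K" "t = (\<lambda>\<xi>. \<Sum>k\<in>K. h k * character (lat k) \<xi>)"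
    and L: "finite L" "u = (\<lambda>\<xi>. \<Sum>k\<in>L. g k * character (lat k) \<xi>)"
    using assms unfolding trig_poly_def by blast
  show thesis
  proof (rule that[of "K \<union> L" "\<lambda>k. if k \<in> K then h k else 0" "\<lambda>k. if k \<in> L then g k else 0"])
    show "t = (\<lambda>\<xi>. \<Sum>k\<in>K \<union> L. (if k \<in> K then h k else 0) * character (lat k) \<xi>)"
      unfolding K(2) using K(1) L(1) by (intro ext sum.mono_neutral_cong_left) auto
    show "u = (\<lambda>\<xi>. \<Sum>k\<in>K \<union> L. (if k \<in> L then g k else 0) * character (lat k) \<xi>)"
      unfolding L(2) using K(1) L(1) by (intro ext sum.mono_neutral_cong_left) auto
  qed (use K L in auto)
qed

lemma trig_poly_add: "trig_poly t \<Longrightarrow> trig_poly u \<Longrightarrow> trig_poly (\<lambda>\<xi>. t \<xi> + u \<xi>)"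
proof -
  assume "trig_poly t" "trig_poly u"
  then obtain K h g where K: "finite K" "t = (\<lambda>\<xi>. \<Sum>k\<in>K. h k * character (lat k) \<xi>)"
    "u = (\<lambda>\<xi>. \<Sum>k\<in>K. g k * character (lat k) \<xi>)"
    by (rule trig_poly_common_support)
  have "(\<lambda>\<xi>. t \<xi> + u \<xi>) = (\<lambda>\<xi>. \<Sum>k\<in>K. (h k + g k) * character (lat k) \<xi>)"
    unfolding K by (simp add: distrib_right sum.distrib)
  then show ?thesis
    unfolding trig_poly_def by (intro exI conjI) (rule K(1), assumption)
qed

lemma trig_poly_sum: "(\<And>i. i \<in> I \<Longrightarrow> trig_poly (t i)) \<Longrightarrow> trig_poly (\<lambda>\<xi>. \<Sum>i\<in>I. t i \<xi>)"
  by (induction I rule: infinite_finite_induct) (auto intro: trig_poly_const trig_poly_add)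

lemma trig_poly_mult:
  assumes "trig_poly t" "trig_poly u"
  shows "trig_poly (\<lambda>\<xi>. t \<xi> * u \<xi>)"
proof -
  obtain K h L g where K: "finite K" "t = (\<lambda>\<xi>. \<Sum>k\<in>K. h k * character (lat k) \<xi>)"
    and L: "finite L" "u = (\<lambda>\<xi>. \<Sum>k\<in>L. g k * character (lat k) \<xi>)"
    using assms unfolding trig_poly_def by blast
  have lat: "lat (k + l) = lat k + lat l" for k l by (simp add: vec_eq_iff)
  have "(\<lambda>\<xi>. t \<xi> * u \<xi>) = (\<lambda>\<xi>. \<Sum>k\<in>K. \<Sum>l\<in>L. (h k * g l) * character (lat (k + l)) \<xi>)"
    unfolding K L lat sum_product by (simp add: character_add mult_ac)
  then show ?thesis
    by (simp only:) (intro trig_poly_sum trig_poly_monomial)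
qed

lemma trig_poly_cnj:
  assumes "trig_poly t"
  shows "trig_poly (\<lambda>\<xi>. cnj (t \<xi>))"
proof -
  obtain K h where K: "finite K" "t = (\<lambda>\<xi>. \<Sum>k\<in>K. h k * character (lat k) \<xi>)"
    using assms unfolding trig_poly_def by blast
  have lat: "- lat k = lat (- k)" for k by (simp add: vec_eq_iff)
  show ?thesis
    unfolding K by (simp only: cnj_sum complex_cnj_mult cnj_character lat) (intro trig_poly_sum trig_poly_monomial)
qed

lemma trig_poly_cmult: "trig_poly t \<Longrightarrow> trig_poly (\<lambda>\<xi>. a * t \<xi>)"
  by (intro trig_poly_mult trig_poly_const)

lemma trig_poly_diff: "trig_poly t \<Longrightarrow> trig_poly u \<Longrightarrow> trig_poly (\<lambda>\<xi>. t \<xi> - u \<xi>)"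
  using trig_poly_add[OF _ trig_poly_cmult[of u "-1"], of t] by simp

lemmas trig_poly_intros = trig_poly_character trig_poly_const trig_poly_sum trig_poly_mult
  trig_poly_cnj trig_poly_diff trig_poly_add

section \<open>Vanishing moments as conditions on the coefficients\<close>

lemma partial_derivative_exponential_sum:
  fixes x :: "'i \<Rightarrow> real^2"
  shows "partial_derivative i (\<lambda>\<xi>. \<Sum>k\<in>K. h k * character (x k) \<xi>)
    = (\<lambda>\<xi>. \<Sum>k\<in>K. h k * (2 * of_real pi * \<i> * of_real (x k $ i)) * character (x k) \<xi>)"
proof
  fix \<xi>
  have ax: "x k \<bullet> axis i 1 = x k $ i" for k by (simp add: inner_axis)
  have "((\<lambda>r. \<Sum>k\<in>K. h k * character (x k) (\<xi> + r *\<^sub>R axis i 1)) has_vector_derivative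
     (\<Sum>k\<in>K. h k * (2 * of_real pi * \<i> * of_real (x k $ i)) * character (x k) \<xi>)) (at 0)"
    unfolding character_def inner_add_right inner_scaleR_right ax
    by (auto intro!: derivative_eq_intros has_vector_derivative_real_field simp: algebra_simps)
  then show "partial_derivative i (\<lambda>\<xi>. \<Sum>k\<in>K. h k * character (x k) \<xi>) \<xi> =
      (\<Sum>k\<in>K. h k * (2 * of_real pi * \<i> * of_real (x k $ i)) * character (x k) \<xi>)"
    unfolding partial_derivative_def by (rule vector_derivative_at)
qed

text \<open>
  The frequencies are real and not only integral, because the sum rule differentiates
  a mask composed with the inverse of the dilation.
\<close>

lemma multi_derivative_exponential_sum:
  fixes x :: "'i \<Rightarrow> real^2"
  shows "multi_derivative \<beta> (\<lambda>\<xi>. \<Sum>k\<in>K. h k * character (x k) \<xi>)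
    = (\<lambda>\<xi>. (2 * of_real pi * \<i>) ^ (\<beta> $ 1 + \<beta> $ 2) *
        (\<Sum>k\<in>K. h k * of_real (x k $ 1) ^ (\<beta> $ 1) * of_real (x k $ 2) ^ (\<beta> $ 2) * character (x k) \<xi>))"
proof -
  have iter: "(partial_derivative i ^^ b) (\<lambda>\<xi>. \<Sum>k\<in>K. g k * character (x k) \<xi>)
    = (\<lambda>\<xi>. \<Sum>k\<in>K. g k * (2 * of_real pi * \<i> * of_real (x k $ i)) ^ b * character (x k) \<xi>)"
    for i b and g :: "'i \<Rightarrow> complex"
  proof (induction b)
    case (Suc b)
    show ?case
      by (simp only: funpow.simps o_apply Suc.IH partial_derivative_exponential_sum) (simp add: mult_ac)
  qed simp
  show ?thesis
    unfolding multi_derivative_def iter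
    by (simp add: sum_distrib_left power_mult_distrib power_add mult_ac)
qed

text \<open>
  Differentiating at the origin turns each character into a monomial in its frequency, so
  vanishing moments are a linear condition on the coefficients.  The frequencies are indexed by an
  arbitrary family, and may repeat, so that products and conjugates need no regrouping.
\<close>

lemma vanishing_moments_iff:
  fixes x :: "'i \<Rightarrow> real^2"
  shows "vanishing_moments n (\<lambda>\<xi>. \<Sum>k\<in>K. h k * character (x k) \<xi>) \<longleftrightarrow>
    (\<forall>a b. a + b < n \<longrightarrow> (\<Sum>k\<in>K. h k * of_real (x k $ 1) ^ a * of_real (x k $ 2) ^ b) = 0)"
    (is "?L \<longleftrightarrow> ?R")
proof
  assume L: ?L
  show ?R
  proof (intro allI impI)
    fix a b :: nat assume "a + b < n"
    then have "(vector [a, b] :: nat^2) \<in> Delta n" by (simp add: Delta_def vector_2)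
    with L show "(\<Sum>k\<in>K. h k * of_real (x k $ 1) ^ a * of_real (x k $ 2) ^ b) = 0"
      unfolding vanishing_moments_def multi_derivative_exponential_sum
      by (auto simp: vector_2 dest!: bspec)
  qed
qed (auto simp: vanishing_moments_def multi_derivative_exponential_sum Delta_def)

lemma vanishing_moments_add:
  assumes "trig_poly t" "trig_poly u" "vanishing_moments n t" "vanishing_moments n u"
  shows "vanishing_moments n (\<lambda>\<xi>. t \<xi> + u \<xi>)"
proof -
  obtain K h g where K: "finite K" "t = (\<lambda>\<xi>. \<Sum>k\<in>K. h k * character (lat k) \<xi>)"
    "u = (\<lambda>\<xi>. \<Sum>k\<in>K. g k * character (lat k) \<xi>)"
    using assms(1,2) by (rule trig_poly_common_support)
  have eq: "(\<lambda>\<xi>. t \<xi> + u \<xi>) = (\<lambda>\<xi>. \<Sum>k\<in>K. (h k + g k) * character (lat k) \<xi>)"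
    unfolding K by (simp add: distrib_right sum.distrib)
  show ?thesis
    using assms(3,4) unfolding eq unfolding K vanishing_moments_iff
    by (simp add: distrib_right sum.distrib)
qed

text \<open>
  By the binomial theorem a translated moment is a combination of moments of at most the same
  order.  This is what makes the functions with vanishing moments an ideal among the
  trigonometric polynomials: multiplication by a character translates the frequencies.
\<close>

lemma moments_translate:
  fixes x y :: "'i \<Rightarrow> complex"
  assumes "\<And>a b. a + b < n \<Longrightarrow> (\<Sum>k\<in>K. h k * x k ^ a * y k ^ b) = 0" and "a + b < n"
  shows "(\<Sum>k\<in>K. h k * (x k + u) ^ a * (y k + v) ^ b) = 0"
proof -
  have "(\<Sum>k\<in>K. h k * (x k + u) ^ a * (y k + v) ^ b) =
    (\<Sum>k\<in>K. \<Sum>i\<le>a. \<Sum>j\<le>b. of_nat (a choose i) * of_nat (b choose j) * u ^ (a - i) * v ^ (b - j)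
       * (h k * x k ^ i * y k ^ j))"
    unfolding binomial_ring mult.assoc[of "h _" "sum _ _"] sum_product
    by (simp add: sum_distrib_left mult_ac)
  also have "\<dots> = (\<Sum>i\<le>a. \<Sum>j\<le>b. of_nat (a choose i) * of_nat (b choose j) * u ^ (a - i) * v ^ (b - j)
       * (\<Sum>k\<in>K. h k * x k ^ i * y k ^ j))"
    by (subst sum.swap, intro sum.cong refl, subst sum.swap) (simp add: sum_distrib_left)
  also have "\<dots> = 0"
    using assms by (intro sum.neutral ballI) auto
  finally show ?thesis .
qed

lemma vanishing_moments_mult:
  assumes "trig_poly t" "trig_poly u" "vanishing_moments n t"
  shows "vanishing_moments n (\<lambda>\<xi>. t \<xi> * u \<xi>)"
proof -
  obtain K h L g where K: "finite K" "t = (\<lambda>\<xi>. \<Sum>k\<in>K. h k * character (lat k) \<xi>)"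
    and L: "finite L" "u = (\<lambda>\<xi>. \<Sum>l\<in>L. g l * character (lat l) \<xi>)"
    using assms unfolding trig_poly_def by blast
  have eq: "(\<lambda>\<xi>. t \<xi> * u \<xi>) = (\<lambda>\<xi>. \<Sum>p\<in>L \<times> K. (g (fst p) * h (snd p)) *
      character (lat (snd p) + lat (fst p)) \<xi>)"
    unfolding K L sum_product
    by (subst sum.swap) (simp add: character_add mult_ac sum.cartesian_product split_def)
  show ?thesis
    unfolding eq vanishing_moments_iff
  proof (intro allI impI)
    fix a b :: nat assume ab: "a + b < n"
    have mom: "(\<Sum>k\<in>K. h k * of_real (of_int (k $ 1)) ^ a * of_real (of_int (k $ 2)) ^ b) = 0"
      if "a + b < n" for a b
      using assms(3) that unfolding K vanishing_moments_iff by simp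
    have "(\<Sum>p\<in>L \<times> K. g (fst p) * h (snd p) * of_real ((lat (snd p) + lat (fst p)) $ 1) ^ a *
          of_real ((lat (snd p) + lat (fst p)) $ 2) ^ b) =
        (\<Sum>l\<in>L. g l * (\<Sum>k\<in>K. h k * (of_real (of_int (k $ 1)) + of_real (of_int (l $ 1))) ^ a *
          (of_real (of_int (k $ 2)) + of_real (of_int (l $ 2))) ^ b))"
      by (simp add: sum.cartesian_product split_def sum_distrib_left mult_ac)
    also have "\<dots> = 0"
      using moments_translate[OF mom ab] by simp
    finally show "(\<Sum>p\<in>L \<times> K. g (fst p) * h (snd p) * of_real ((lat (snd p) + lat (fst p)) $ 1) ^ a *
          of_real ((lat (snd p) + lat (fst p)) $ 2) ^ b) = 0" .
  qed
qed

lemma vanishing_moments_cnj: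
  assumes "trig_poly t" "vanishing_moments n t"
  shows "vanishing_moments n (\<lambda>\<xi>. cnj (t \<xi>))"
proof -
  obtain K h where K: "finite K" "t = (\<lambda>\<xi>. \<Sum>k\<in>K. h k * character (lat k) \<xi>)"
    using assms unfolding trig_poly_def by blast
  have eq: "(\<lambda>\<xi>. cnj (t \<xi>)) = (\<lambda>\<xi>. \<Sum>k\<in>K. cnj (h k) * character (- lat k) \<xi>)"
    by (simp add: K cnj_character)
  show ?thesis
    unfolding eq vanishing_moments_iff
  proof (intro allI impI)
    fix a b :: nat assume ab: "a + b < n"
    have "(\<Sum>k\<in>K. cnj (h k) * of_real ((- lat k) $ 1) ^ a * of_real ((- lat k) $ 2) ^ b) =
      (- 1) ^ a * (- 1) ^ b *
        cnj (\<Sum>k\<in>K. h k * of_real (lat k $ 1) ^ a * of_real (lat k $ 2) ^ b)"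
      by (simp add: sum_distrib_left power_minus[of "of_int _"] mult_ac)
    also have "\<dots> = 0"
      using assms(2) ab unfolding K vanishing_moments_iff by simp
    finally show "(\<Sum>k\<in>K. cnj (h k) * of_real ((- lat k) $ 1) ^ a * of_real ((- lat k) $ 2) ^ b) = 0" .
  qed
qed

lemma vanishing_moments_sum:
  assumes "\<And>i. i \<in> I \<Longrightarrow> trig_poly (t i)" "\<And>i. i \<in> I \<Longrightarrow> vanishing_moments n (t i)"
  shows "vanishing_moments n (\<lambda>\<xi>. \<Sum>i\<in>I. t i \<xi>)"
  using assms
proof (induction I rule: infinite_finite_induct)
  case (insert i I)
  then show ?case by (simp add: vanishing_moments_add trig_poly_sum)
qed (use vanishing_moments_iff[of n _ _ "{}"] in auto)

section \<open>Coset parts and the mixed extension principle\<close>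

definition coset_part ::
    "int^2^2 \<Rightarrow> (int^2) set \<Rightarrow> (int^2 \<Rightarrow> complex) \<Rightarrow> int^2 \<Rightarrow> real^2 \<Rightarrow> complex"
  where "coset_part M K h d \<xi> =
    (\<Sum>k | k \<in> K \<and> k - d \<in> range ((*v) M). h k * character (lat k) \<xi>)"

lemma trig_poly_coset_part: "trig_poly (coset_part M K h d)"
  unfolding coset_part_def[abs_def] by (intro trig_poly_sum trig_poly_monomial)

text \<open>
  Every frequency lies in the coset of exactly one digit.
\<close>

lemma sum_coset_part:
  assumes d: "digit_enumeration M d" and K: "finite K"
  shows "(\<Sum>i<index M. coset_part M K h (d i) \<xi>) = (\<Sum>k\<in>K. h k * character (lat k) \<xi>)"
proof -
  have uniq: "card {i. i < index M \<and> k - d i \<in> range ((*v) M)} = 1" for k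
  proof -
    from d have inj: "inj_on d {..<index M}" and dig: "digit_set M (d ` {..<index M})"
      unfolding digit_enumeration_def by auto
    from dig have ex1: "\<exists>!e. e \<in> d ` {..<index M} \<and> k - e \<in> range ((*v) M)"
      unfolding digit_set_def by (rule spec)
    then obtain i where i: "i < index M" "k - d i \<in> range ((*v) M)" by blast
    have u: "d j = d i" if "j < index M" "k - d j \<in> range ((*v) M)" for j
      using ex1 i that by blast
    have "j = i" if "j < index M" "k - d j \<in> range ((*v) M)" for j
      using inj_onD[OF inj u[OF that]] that(1) i(1) by simp
    then have "{i. i < index M \<and> k - d i \<in> range ((*v) M)} = {i}"
      using i by blast
    then show ?thesis by simp
  qed
  have "(\<Sum>i<index M. coset_part M K h (d i) \<xi>) =
      (\<Sum>i<index M. \<Sum>k\<in>K. if k - d i \<in> range ((*v) M) then h k * character (lat k) \<xi> else 0)"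
    unfolding coset_part_def using K by (simp add: sum.inter_filter)
  also have "\<dots> = (\<Sum>k\<in>K. \<Sum>i<index M. if k - d i \<in> range ((*v) M) then h k * character (lat k) \<xi> else 0)"
    by (rule sum.swap)
  also have "\<dots> = (\<Sum>k\<in>K. h k * character (lat k) \<xi>)"
  proof (rule sum.cong[OF refl])
    fix k
    have "(\<Sum>i<index M. if k - d i \<in> range ((*v) M) then h k * character (lat k) \<xi> else 0)
        = (\<Sum>i | i < index M \<and> k - d i \<in> range ((*v) M). h k * character (lat k) \<xi>)"
      using sum.inter_filter[of "{..<index M}"
          "\<lambda>_. h k * character (lat k) \<xi>" "\<lambda>i. k - d i \<in> range ((*v) M)"] by simp
    also have "\<dots> = h k * character (lat k) \<xi>" using uniq[of k] by simp
    finally show "(\<Sum>i<index M. if k - d i \<in> range ((*v) M) then h k * character (lat k) \<xi> else 0)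
        = h k * character (lat k) \<xi>" .
  qed
  finally show ?thesis .
qed

text \<open>
  A frequency in the coset of \<open>d\<close> is \<open>d + M z\<close>, and the character of \<open>M z\<close> at \<open>\<xi>\<close> is the character
  of \<open>z\<close> at \<open>M\<^sup>T \<xi>\<close>.  Collecting the terms coset by coset therefore produces the polyphase
  components.
\<close>

lemma polyphase_components_exist:
  assumes d: "digit_enumeration M d" and K: "finite K" and m: "index M > 0"
  obtains \<tau> where "polyphase_components M d (\<lambda>\<xi>. \<Sum>k\<in>K. h k * character (lat k) \<xi>) \<tau>"
    and "\<And>i \<xi>. character (lat (d i)) \<xi> * \<tau> i (map_matrix of_int (transpose M) *v \<xi>) =
      of_real (sqrt (real (index M))) * coset_part M K h (d i) \<xi>"
proof -
  define r :: complex where "r = of_real (sqrt (real (index M)))"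
  have r: "r \<noteq> 0" using m by (simp add: r_def)
  define z where "z x = (SOME z. x = M *v z)" for x
  have z: "M *v z x = x" if "x \<in> range ((*v) M)" for x
  proof -
    from that obtain y where "x = M *v y" by blast
    then have "x = M *v z x" unfolding z_def by (rule someI)
    then show ?thesis by simp
  qed
  define \<tau> where "\<tau> i \<xi> = (\<Sum>k | k \<in> K \<and> k - d i \<in> range ((*v) M).
      r * h k * character (lat (z (k - d i))) \<xi>)" for i \<xi>
  have part: "character (lat (d i)) \<xi> * \<tau> i (map_matrix of_int (transpose M) *v \<xi>) =
      r * coset_part M K h (d i) \<xi>" for i \<xi>
  proof -
    have "character (lat (d i)) \<xi> * character (lat (z (k - d i))) (map_matrix of_int (transpose M) *v \<xi>)
        = character (lat k) \<xi>" if "k - d i \<in> range ((*v) M)" for k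
    proof -
      have "lat k = lat (d i) + lat (k - d i)" by (simp add: vec_eq_iff)
      then show ?thesis
        by (simp only: z[OF that] character_add flip: character_lat_mult)
    qed
    then show ?thesis
      unfolding \<tau>_def coset_part_def sum_distrib_left
      by (intro sum.cong refl) (simp add: mult_ac)
  qed
  show thesis
  proof (rule that)
    have "trig_poly (\<tau> i)" for i
      unfolding \<tau>_def[abs_def] by (intro trig_poly_sum trig_poly_monomial)
    moreover have "(\<Sum>k\<in>K. h k * character (lat k) \<xi>) = 1 / r * (\<Sum>i<index M. character (lat (d i)) \<xi> *
        \<tau> i (map_matrix of_int (transpose M) *v \<xi>))" for \<xi>
      using r by (simp add: part sum_distrib_left[symmetric] sum_coset_part[OF d K])
    ultimately show "polyphase_components M d (\<lambda>\<xi>. \<Sum>k\<in>K. h k * character (lat k) \<xi>) \<tau>"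
      unfolding polyphase_components_def r_def by blast
  qed (use part in \<open>simp add: r_def\<close>)
qed

lemma trig_poly_dilate:
  assumes "trig_poly t"
  shows "trig_poly (\<lambda>\<xi>. t (map_matrix of_int (transpose M) *v \<xi>))"
proof -
  obtain K h where t: "t = (\<lambda>\<xi>. \<Sum>k\<in>K. h k * character (lat k) \<xi>)"
    using assms unfolding trig_poly_def by blast
  have "trig_poly (\<lambda>\<xi>. \<Sum>k\<in>K. h k * character (lat (M *v k)) \<xi>)"
    by (intro trig_poly_sum trig_poly_monomial)
  then show ?thesis unfolding t by (simp only: character_lat_mult)
qed

lemma polyphase_components_trig_poly:
  assumes "polyphase_components M d t \<tau>"
  shows "trig_poly t"
proof -
  have "t = (\<lambda>\<xi>. 1 / of_real (sqrt (real (index M))) *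
      (\<Sum>k<index M. character (lat (d k)) \<xi> * \<tau> k (map_matrix of_int (transpose M) *v \<xi>)))"
    using assms unfolding polyphase_components_def by blast
  moreover have "trig_poly (\<lambda>\<xi>. 1 / of_real (sqrt (real (index M))) *
      (\<Sum>k<index M. character (lat (d k)) \<xi> * \<tau> k (map_matrix of_int (transpose M) *v \<xi>)))"
    using assms unfolding polyphase_components_def
    by (intro trig_poly_intros trig_poly_dilate) auto
  ultimately show ?thesis by (simp only:)
qed

lemma polyphase_components_change_digits:
  assumes "polyphase_components M d t \<tau>" and "\<And>k. k < index M \<Longrightarrow> d k = s k + M *v z k"
  shows "polyphase_components M s t (\<lambda>k \<xi>. character (lat (z k)) \<xi> * \<tau> k \<xi>)"
proof -
  have "character (lat (d k)) \<xi> = character (lat (s k)) \<xi> *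
      character (lat (z k)) (map_matrix of_int (transpose M) *v \<xi>)" if "k < index M" for k \<xi>
  proof -
    have "lat (d k) = lat (s k) + lat (M *v z k)" using assms(2)[OF that] by (simp add: vec_eq_iff)
    then show ?thesis by (simp only: character_add flip: character_lat_mult)
  qed
  with assms(1) show ?thesis
    unfolding polyphase_components_def by (auto intro!: trig_poly_intros simp: mult_ac)
qed

text \<open>
  Replacing a digit by another representative of its coset multiplies a whole column of each
  polyphase matrix by the same character, which has modulus one; the mixed extension principle
  is unaffected by it.  Hence the digits may be chosen to suit the symmetry.
\<close>

lemma wavelet_masks_change_digits:
  assumes "wavelet_masks M d f f'" and ds: "\<And>k. k < index M \<Longrightarrow> d k - s k \<in> range ((*v) M)"
  shows "wavelet_masks M s f f'"
proof -
  from assms(1) obtain \<mu> \<mu>' where \<mu>: "\<forall>\<nu> \<le> index M.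
      polyphase_components M d (f \<nu>) (\<mu> \<nu>) \<and> polyphase_components M d (f' \<nu>) (\<mu>' \<nu>)"
    and orth: "\<forall>j < index M. \<forall>k < index M. \<forall>\<xi>.
      (\<Sum>\<nu>\<le>index M. \<mu> \<nu> j \<xi> * cnj (\<mu>' \<nu> k \<xi>)) = (if j = k then 1 else 0)"
    unfolding wavelet_masks_def by (elim conjE exE)
  have "\<exists>z. d k = s k + M *v z" if "k < index M" for k
  proof -
    from ds[OF that] obtain z where "d k - s k = M *v z" by blast
    then have "d k = s k + M *v z" by (simp add: diff_eq_eq add.commute)
    then show ?thesis ..
  qed
  then obtain z where z: "\<And>k. k < index M \<Longrightarrow> d k = s k + M *v z k" by metis
  let ?\<nu> = "\<lambda>\<mu> \<nu> k \<xi>. character (lat (z k)) \<xi> * (\<mu> \<nu> k \<xi> :: complex)"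
  have "(\<Sum>\<nu>\<le>index M. ?\<nu> \<mu> \<nu> j \<xi> * cnj (?\<nu> \<mu>' \<nu> k \<xi>)) = (if j = k then 1 else 0)"
    if "j < index M" "k < index M" for j k \<xi>
  proof -
    have "(\<Sum>\<nu>\<le>index M. ?\<nu> \<mu> \<nu> j \<xi> * cnj (?\<nu> \<mu>' \<nu> k \<xi>)) =
        character (lat (z j)) \<xi> * cnj (character (lat (z k)) \<xi>) *
          (\<Sum>\<nu>\<le>index M. \<mu> \<nu> j \<xi> * cnj (\<mu>' \<nu> k \<xi>))"
      by (simp add: sum_distrib_left mult_ac)
    then show ?thesis
      using orth that by (auto simp: character_mult_cnj)
  qed
  moreover have "polyphase_components M s (f \<nu>) (?\<nu> \<mu> \<nu>)"
    "polyphase_components M s (f' \<nu>) (?\<nu> \<mu>' \<nu>)" if "\<nu> \<le> index M" for \<nu>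
    using \<mu> that by (auto intro!: polyphase_components_change_digits[OF _ z])
  ultimately show ?thesis
    using assms(1) unfolding wavelet_masks_def
    by (intro conjI exI[of _ "?\<nu> \<mu>"] exI[of _ "?\<nu> \<mu>'"]) simp_all
qed

text \<open>
  The wavelet rows of the polyphase matrices are \<open>V\<close> and \<open>V (I - \<mu>\<^sup>* \<mu>')\<close>, where \<open>\<mu>\<^sup>*\<close> is the
  conjugate transpose of the row \<open>\<mu>\<close>.  Since \<open>V\<^sup>T V = I\<close>, they contribute \<open>I - \<mu>\<^sup>T cnj(\<mu>')\<close> to the
  product in the mixed extension principle, and the rows of \<open>t\<close> and \<open>t'\<close> contribute the missing
  \<open>\<mu>\<^sup>T cnj(\<mu>')\<close>.
\<close>

lemma mixed_extension:
  fixes M :: "int^2^2" and V :: "nat \<Rightarrow> nat \<Rightarrow> real"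
  defines "r \<equiv> complex_of_real (sqrt (real (index M)))"
  assumes m: "index M > 0"
    and \<mu>: "polyphase_components M d t \<mu>" and \<mu>': "polyphase_components M d t' \<mu>'"
    and V: "\<And>j k. j < index M \<Longrightarrow> k < index M \<Longrightarrow>
      (\<Sum>i<index M. V i j * V i k) = (if j = k then 1 else 0)"
  shows "wavelet_masks M d
    (case_nat t (\<lambda>i \<xi>. \<Sum>k<index M. of_real (V i k) * (character (lat (d k)) \<xi> / r)))
    (case_nat t' (\<lambda>i \<xi>. \<Sum>k<index M. of_real (V i k) * (character (lat (d k)) \<xi> / r -
        cnj (\<mu> k (map_matrix of_int (transpose M) *v \<xi>)) * t' \<xi>)))"
    (is "wavelet_masks M d ?f ?f'")
proof -
  let ?A = "(*v) (map_matrix of_int (transpose M)) :: real^2 \<Rightarrow> real^2"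
  have r: "r \<noteq> 0" using m by (simp add: r_def)
  define \<rho> where "\<rho> = case_nat \<mu> (\<lambda>i k \<xi>. complex_of_real (V i k))"
  define \<rho>' where "\<rho>' = case_nat \<mu>' (\<lambda>i k \<xi>. complex_of_real (V i k) -
    (\<Sum>l<index M. of_real (V i l) * cnj (\<mu> l \<xi>)) * \<mu>' k \<xi>)"
  have trig: "trig_poly (\<mu> k)" "trig_poly (\<mu>' k)" if "k < index M" for k
    using \<mu> \<mu>' that unfolding polyphase_components_def by auto
  have t'_eq: "t' \<xi> = 1 / r * (\<Sum>k<index M. character (lat (d k)) \<xi> * \<mu>' k (?A \<xi>))" for \<xi>
    using \<mu>' unfolding polyphase_components_def r_def by blast
  have pp: "polyphase_components M d (?f \<nu>) (\<rho> \<nu>)" for \<nu>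
  proof (cases \<nu>)
    case 0
    then show ?thesis using \<mu> by (simp add: \<rho>_def)
  next
    case (Suc i)
    then show ?thesis
      unfolding \<rho>_def polyphase_components_def r_def[symmetric]
      by (auto intro!: trig_poly_intros simp: sum_distrib_left mult_ac)
  qed
  have pp': "polyphase_components M d (?f' \<nu>) (\<rho>' \<nu>)" for \<nu>
  proof (cases \<nu>)
    case 0
    then show ?thesis using \<mu>' by (simp add: \<rho>'_def)
  next
    case (Suc i)
    have "(\<Sum>k<index M. of_real (V i k) * (character (lat (d k)) \<xi> / r - cnj (\<mu> k (?A \<xi>)) * t' \<xi>)) =
      1 / r * (\<Sum>k<index M. character (lat (d k)) \<xi> * (complex_of_real (V i k) -
        (\<Sum>l<index M. of_real (V i l) * cnj (\<mu> l (?A \<xi>))) * \<mu>' k (?A \<xi>)))" for \<xi>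
    proof -
      let ?S = "\<Sum>l<index M. of_real (V i l) * cnj (\<mu> l (?A \<xi>))"
      have "(\<Sum>k<index M. of_real (V i k) * (character (lat (d k)) \<xi> / r - cnj (\<mu> k (?A \<xi>)) * t' \<xi>))
        = (\<Sum>k<index M. of_real (V i k) * (character (lat (d k)) \<xi> / r)) - ?S * t' \<xi>"
        by (simp add: right_diff_distrib sum_subtractf sum_distrib_right mult.assoc)
      also have "\<dots> = 1 / r * ((\<Sum>k<index M. character (lat (d k)) \<xi> * of_real (V i k)) -
          ?S * (\<Sum>k<index M. character (lat (d k)) \<xi> * \<mu>' k (?A \<xi>)))"
        unfolding t'_eq right_diff_distrib by (simp add: sum_divide_distrib[symmetric] mult.commute)
      also have "\<dots> = 1 / r * (\<Sum>k<index M. character (lat (d k)) \<xi> * (complex_of_real (V i k) -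
          ?S * \<mu>' k (?A \<xi>)))"
        unfolding right_diff_distrib sum_subtractf sum_distrib_left[of ?S]
        by (simp add: mult.left_commute)
      finally show ?thesis .
    qed
    with Suc show ?thesis
      unfolding \<rho>'_def polyphase_components_def r_def[symmetric]
      by (auto intro!: trig_poly_intros trig)
  qed
  have "(\<Sum>\<nu>\<le>index M. \<rho> \<nu> j \<xi> * cnj (\<rho>' \<nu> k \<xi>)) = (if j = k then 1 else 0)"
    if jk: "j < index M" "k < index M" for j k \<xi>
  proof -
    have V': "(\<Sum>i<index M. complex_of_real (V i j) * of_real (V i l)) = (if j = l then 1 else 0)"
      if "l < index M" for l
      using arg_cong[OF V[OF jk(1) that], of complex_of_real] by simp
    have "(\<Sum>\<nu>\<le>index M. \<rho> \<nu> j \<xi> * cnj (\<rho>' \<nu> k \<xi>)) = \<mu> j \<xi> * cnj (\<mu>' k \<xi>) +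
        (\<Sum>i<index M. of_real (V i j) * (of_real (V i k) -
          (\<Sum>l<index M. of_real (V i l) * \<mu> l \<xi>) * cnj (\<mu>' k \<xi>)))"
      by (simp add: \<rho>_def \<rho>'_def lessThan_Suc_atMost[symmetric] sum.lessThan_Suc_shift
          del: sum.lessThan_Suc)
    also have "(\<Sum>i<index M. of_real (V i j) * (of_real (V i k) -
          (\<Sum>l<index M. of_real (V i l) * \<mu> l \<xi>) * cnj (\<mu>' k \<xi>))) =
        (\<Sum>i<index M. complex_of_real (V i j) * of_real (V i k)) -
        (\<Sum>i<index M. \<Sum>l<index M. of_real (V i j) * of_real (V i l) * \<mu> l \<xi>) * cnj (\<mu>' k \<xi>)"
      by (simp add: right_diff_distrib sum_subtractf sum_distrib_left sum_distrib_right mult.assoc)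
    also have "(\<Sum>i<index M. \<Sum>l<index M. of_real (V i j) * of_real (V i l) * \<mu> l \<xi>) =
        (\<Sum>l<index M. (\<Sum>i<index M. complex_of_real (V i j) * of_real (V i l)) * \<mu> l \<xi>)"
      by (subst sum.swap) (simp add: sum_distrib_right)
    also have "\<dots> = (\<Sum>l<index M. if j = l then \<mu> l \<xi> else 0)"
      by (intro sum.cong refl) (simp add: V')
    finally show ?thesis using jk by (simp add: V')
  qed
  moreover have "trig_poly (?f \<nu>)" "trig_poly (?f' \<nu>)" for \<nu>
    by (rule polyphase_components_trig_poly[OF pp] polyphase_components_trig_poly[OF pp'])+
  ultimately show ?thesis
    unfolding wavelet_masks_def
    by (intro conjI allI impI exI[of _ \<rho>] exI[of _ \<rho>']) (assumption | rule pp pp')+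
qed

section \<open>Digit sets and character sums\<close>

lemma range_mult_vec_diff:
  fixes N :: "int^2^2"
  assumes "x \<in> range ((*v) N)" "y \<in> range ((*v) N)"
  shows "x - y \<in> range ((*v) N)"
  using assms by (auto simp flip: matrix_vector_mult_diff_distrib)

lemma range_mult_vec_minus:
  fixes N :: "int^2^2"
  assumes "x - y \<in> range ((*v) N)"
  shows "y - x \<in> range ((*v) N)"
proof -
  have "0 \<in> range ((*v) N)" by (rule range_eqI[of _ _ 0]) simp
  from range_mult_vec_diff[OF this assms] show ?thesis by simp
qed

definition digit_rep :: "int^2^2 \<Rightarrow> (int^2) set \<Rightarrow> int^2 \<Rightarrow> int^2"
  where "digit_rep N D x = (THE d. d \<in> D \<and> x - d \<in> range ((*v) N))"

lemma digit_rep: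
  assumes "digit_set N D"
  shows "digit_rep N D x \<in> D" "x - digit_rep N D x \<in> range ((*v) N)"
  using assms theI'[of "\<lambda>d. d \<in> D \<and> x - d \<in> range ((*v) N)"]
  unfolding digit_set_def digit_rep_def by blast+

lemma digit_set_unique:
  assumes "digit_set N D" "d \<in> D" "e \<in> D" "d - e \<in> range ((*v) N)"
  shows "d = e"
proof -
  have "d - d \<in> range ((*v) N)" using assms(4) range_mult_vec_diff by fastforce
  with assms show ?thesis unfolding digit_set_def by blast
qed

text \<open>
  Any two digit sets of the same matrix can be exchanged in sums of functions on the cosets.
\<close>

lemma digit_rep_bij:
  assumes A: "digit_set N A" and B: "digit_set N B"
  shows "bij_betw (digit_rep N B) A B"
proof (rule bij_betwI[where g = "digit_rep N A"])
  have inv: "digit_rep N D (digit_rep N D' x) = x"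
    if "digit_set N D" "digit_set N D'" "x \<in> D" for D D' x
  proof (rule digit_set_unique[OF that(1)])
    have "(digit_rep N D' x - digit_rep N D (digit_rep N D' x)) - (digit_rep N D' x - x)
        \<in> range ((*v) N)"
      by (rule range_mult_vec_diff[OF digit_rep(2)[OF that(1)]
            range_mult_vec_minus[OF digit_rep(2)[OF that(2)]]])
    then have "x - digit_rep N D (digit_rep N D' x) \<in> range ((*v) N)" by simp
    then show "digit_rep N D (digit_rep N D' x) - x \<in> range ((*v) N)"
      by (rule range_mult_vec_minus)
  qed (simp_all add: digit_rep(1) that)
  show "digit_rep N A (digit_rep N B x) = x" if "x \<in> A" for x by (rule inv[OF A B that])
  show "digit_rep N B (digit_rep N A x) = x" if "x \<in> B" for x by (rule inv[OF B A that])
qed (simp_all add: digit_rep(1) A B)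

text \<open>
  Orthogonality of characters on the finite quotient group.  The translate of a digit set by
  \<open>z\<close> is a digit set again, so the sum \<open>S\<close> over the digits satisfies \<open>S = \<phi> z * S\<close>; it vanishes as soon
  as some value of \<open>\<phi>\<close> differs from 1.
\<close>

lemma digit_character_sum:
  fixes \<phi> :: "int^2 \<Rightarrow> complex"
  assumes D: "digit_set N D"
    and add: "\<And>x y. \<phi> (x + y) = \<phi> x * \<phi> y" and ker: "\<And>x. x \<in> range ((*v) N) \<Longrightarrow> \<phi> x = 1"
  shows "(\<Sum>r\<in>D. \<phi> r) = (if \<forall>z. \<phi> z = 1 then of_nat (card D) else 0)"
proof (cases "\<forall>z. \<phi> z = 1")
  case False
  then obtain z where z: "\<phi> z \<noteq> 1" by blast
  have D': "digit_set N ((+) z ` D)"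
    unfolding digit_set_def
  proof
    fix x
    have "\<exists>!d. d \<in> D \<and> (x - z) - d \<in> range ((*v) N)"
      using D unfolding digit_set_def by blast
    then obtain d where d: "d \<in> D" "(x - z) - d \<in> range ((*v) N)"
      and u: "\<And>e. e \<in> D \<Longrightarrow> (x - z) - e \<in> range ((*v) N) \<Longrightarrow> e = d" by blast
    show "\<exists>!e. e \<in> (+) z ` D \<and> x - e \<in> range ((*v) N)"
    proof (rule ex1I[of _ "z + d"])
      show "z + d \<in> (+) z ` D \<and> x - (z + d) \<in> range ((*v) N)"
        using d by (simp add: diff_diff_eq)
      fix e assume "e \<in> (+) z ` D \<and> x - e \<in> range ((*v) N)"
      then show "e = z + d" using u by (auto simp: diff_diff_eq)
    qed
  qed
  have inv: "\<phi> (digit_rep N D x) = \<phi> x" for x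
  proof -
    have "\<phi> x = \<phi> (x - digit_rep N D x) * \<phi> (digit_rep N D x)"
      by (simp flip: add)
    then show ?thesis using ker[OF digit_rep(2)[OF D]] by simp
  qed
  have "(\<Sum>r\<in>D. \<phi> r) = (\<Sum>r\<in>(+) z ` D. \<phi> (digit_rep N D r))"
    using sum.reindex_bij_betw[OF digit_rep_bij[OF D' D], of \<phi>] by simp
  also have "\<dots> = \<phi> z * (\<Sum>r\<in>D. \<phi> r)"
    by (simp add: inv sum.reindex add sum_distrib_left)
  finally show ?thesis using z by auto
qed simp

section \<open>Orthogonal pairing of the residues modulo an integer\<close>

text \<open>
  The representatives modulo \<open>q\<close> centred at \<open>1\<close>, that is \<open>1 - q/2, \<dots>, q/2\<close> for even and
  \<open>(3 - q)/2, \<dots>, (q + 1)/2\<close> for odd \<open>q\<close>.  The reflection \<open>x \<mapsto> 1 - x\<close> preserves this set, except that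
  for odd \<open>q\<close> it moves \<open>(q + 1)/2\<close> to the excluded number \<open>(1 - q)/2\<close> of the same residue class.
\<close>

definition residues :: "int \<Rightarrow> int set"
  where "residues q = {x. 2 - q \<le> 2 * x \<and> 2 * x < 2 + q}"

definition partner :: "int \<Rightarrow> int \<Rightarrow> int"
  where "partner q x = (if 2 * x = q + 1 then x else 1 - x)"

definition butterfly_center :: "int \<Rightarrow> int \<Rightarrow> real"
  where "butterfly_center q x = (if 2 * x = q + 1 then of_int x else 1 / 2)"

definition butterfly_sign :: "int \<Rightarrow> real"
  where "butterfly_sign x = (if x > 0 then 1 else - 1)"

text \<open>
  The orthogonal matrix with rows \<open>x\<close> and columns \<open>y\<close> that replaces each pair \<open>{x, 1 - x}\<close> by
  its normalised sum (row \<open>x > 0\<close>) and difference (row \<open>x \<le> 0\<close>), and fixes the unpaired residue.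
\<close>

definition butterfly :: "int \<Rightarrow> int \<Rightarrow> int \<Rightarrow> real"
  where "butterfly q x y =
    (if 2 * x = q + 1 then (if y = x then 1 else 0)
     else if y = x then butterfly_sign x / sqrt 2
     else if y = 1 - x then 1 / sqrt 2 else 0)"

lemma finite_residues: "finite (residues q)"
proof (rule finite_subset)
  show "residues q \<subseteq> {- \<bar>q\<bar>..\<bar>q\<bar> + 1}" unfolding residues_def by auto
qed simp

lemma residues_ex1:
  assumes "q > 0"
  shows "\<exists>!y. y \<in> residues q \<and> q dvd x - y"
proof -
  define l where "l = (3 - q) div 2"
  have l: "residues q = {l..<l + q}" unfolding residues_def l_def by (auto; presburger)
  show ?thesis
  proof (rule ex1I[of _ "l + (x - l) mod q"])
    have "x - (l + (x - l) mod q) = q * ((x - l) div q)"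
      using mult_div_mod_eq[of q "x - l"] by linarith
    with assms show "l + (x - l) mod q \<in> residues q \<and> q dvd x - (l + (x - l) mod q)"
      by (simp add: l)
  next
    fix y assume y: "y \<in> residues q \<and> q dvd x - y"
    then have "(x - l) mod q = (y - l) mod q"
      by (simp add: mod_eq_dvd_iff)
    also have "\<dots> = y - l" using y by (simp add: l)
    finally show "y = l + (x - l) mod q" by simp
  qed
qed

lemma partner_residues: "x \<in> residues q \<Longrightarrow> partner q x \<in> residues q"
  unfolding residues_def partner_def by auto

lemma partner_partner: "x \<in> residues q \<Longrightarrow> partner q (partner q x) = x"
  unfolding residues_def partner_def by auto

lemma partner_dvd: "q dvd partner q x - (1 - x)"
  unfolding partner_def by (auto simp: algebra_simps)

lemma butterfly_partner:
  assumes "q > 0" "x \<in> residues q" "y \<in> residues q"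
  shows "butterfly q x (partner q y) = butterfly_sign x * butterfly q x y"
  using assms unfolding residues_def partner_def butterfly_def butterfly_sign_def by auto

text \<open>
  On the support of row \<open>x\<close> passing to the partner is a genuine reflection of the integers, about
  a centre that depends on \<open>x\<close> only.
\<close>

lemma butterfly_center:
  assumes "x \<in> residues q" "y \<in> residues q" "butterfly q x y \<noteq> 0"
  shows "of_int (partner q y) = 2 * butterfly_center q x - of_int y"
  using assms unfolding residues_def partner_def butterfly_def butterfly_center_def
  by (auto split: if_splits)

lemma butterfly_orthogonal:
  assumes y: "y \<in> residues q" and z: "z \<in> residues q"
  shows "(\<Sum>x\<in>residues q. butterfly q x y * butterfly q x z) = (if y = z then 1 else 0)"
proof (cases "2 * y = q + 1")
  case True
  have "(\<Sum>x\<in>residues q. butterfly q x y * butterfly q x z) =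
      (\<Sum>x\<in>{y}. butterfly q x y * butterfly q x z)"
    using y True by (intro sum.mono_neutral_right finite_residues) (auto simp: butterfly_def residues_def)
  then show ?thesis using True by (auto simp: butterfly_def)
next
  case False
  have "(\<Sum>x\<in>residues q. butterfly q x y * butterfly q x z) =
      (\<Sum>x\<in>{y, 1 - y}. butterfly q x y * butterfly q x z)"
    using y False by (intro sum.mono_neutral_right finite_residues) (auto simp: butterfly_def residues_def)
  also have "\<dots> = butterfly q y y * butterfly q y z + butterfly q (1 - y) y * butterfly q (1 - y) z"
  proof -
    have "y \<noteq> 1 - y" by presburger
    then show ?thesis by simp
  qed
  also have "\<dots> = (if y = z then 1 else 0)"
    using y z False by (auto simp: butterfly_def butterfly_sign_def residues_def)
  finally show ?thesis .
qed

section \<open>Axial symmetry in coordinates\<close>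

text \<open>
  The four elements of \<open>G_axis\<close>; they are their own transposes.
\<close>

definition mirror :: "bool \<Rightarrow> bool \<Rightarrow> real^2 \<Rightarrow> real^2"
  where "mirror a b x = vector [if a then - x $ 1 else x $ 1, if b then - x $ 2 else x $ 2]"

lemma G_axis_mirror:
  assumes "E \<in> G_axis"
  obtains a b where "\<And>x. E *v x = mirror a b x" "\<And>x. transpose E *v x = mirror a b x"
proof -
  from assms consider "E = mat 1" | "E = - mat 1"
    | "E = vector [vector [-1, 0], vector [0, 1]]" | "E = - vector [vector [-1, 0], vector [0, 1]]"
    unfolding G_axis_def Let_def by blast
  then show thesis
  proof cases
    case 1
    show ?thesis by (rule that[of False False])
      (simp_all add: 1 vec_eq_iff forall_2 mirror_def matrix_vector_mult_def transpose_def mat_def sum_2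
        del: transpose_matrix_vector)
  next
    case 2
    show ?thesis by (rule that[of True True])
      (simp_all add: 2 vec_eq_iff forall_2 mirror_def matrix_vector_mult_def transpose_def mat_def sum_2
        del: transpose_matrix_vector)
  next
    case 3
    show ?thesis by (rule that[of True False])
      (simp_all add: 3 vec_eq_iff forall_2 mirror_def matrix_vector_mult_def transpose_def sum_2
        del: transpose_matrix_vector)
  next
    case 4
    show ?thesis by (rule that[of False True])
      (simp_all add: 4 vec_eq_iff forall_2 mirror_def matrix_vector_mult_def transpose_def sum_2
        del: transpose_matrix_vector)
  qed
qed

lemma mirror_in_G_axis:
  "\<exists>E \<in> G_axis. (\<forall>x. E *v x = mirror a b x) \<and> (\<forall>x. transpose E *v x = mirror a b x)"
proof -
  define E :: "real^2^2" where
    "E = vector [vector [if a then - 1 else 1, 0], vector [0, if b then - 1 else 1]]"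
  have "E \<in> G_axis"
    unfolding G_axis_def E_def
    by (cases a; cases b) (simp_all add: Let_def vec_eq_iff forall_2 mat_def)
  moreover have "E *v x = mirror a b x" "transpose E *v x = mirror a b x" for x
    by (simp_all add: E_def vec_eq_iff forall_2 mirror_def matrix_vector_mult_def transpose_def sum_2
        del: transpose_matrix_vector)
  ultimately show ?thesis by blast
qed

lemma axial_symmetric_mirror:
  assumes "axial_symmetric c t"
  shows "t \<xi> = character (c - mirror a b c) \<xi> * t (mirror a b \<xi>)"
proof -
  obtain E where E: "E \<in> G_axis" "\<And>x. E *v x = mirror a b x" "\<And>x. transpose E *v x = mirror a b x"
    using mirror_in_G_axis[of a b] by blast
  have "t \<xi> = character (c - E *v c) \<xi> * t (transpose E *v \<xi>)"
    using assms E(1) unfolding axial_symmetric_def by blast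
  then show ?thesis unfolding E(2,3) .
qed

lemma axial_antisymmetric_mirrorI:
  assumes c: "c \<in> half_lattice" and \<epsilon>: "\<And>a b. \<epsilon> a b \<in> {1, -1}"
    and t: "\<And>a b \<xi>. t \<xi> = \<epsilon> a b * character (c - mirror a b c) \<xi> * t (mirror a b \<xi>)"
  shows "axial_antisymmetric c t"
  unfolding axial_antisymmetric_def
proof (intro conjI ballI c)
  fix E assume "E \<in> G_axis"
  then obtain a b where E: "\<And>x. E *v x = mirror a b x" "\<And>x. transpose E *v x = mirror a b x"
    using G_axis_mirror by blast
  show "\<exists>\<epsilon>\<in>{1, -1}. \<forall>\<xi>. t \<xi> = \<epsilon> * character (c - E *v c) \<xi> * t (transpose E *v \<xi>)"
    unfolding E using \<epsilon> t by blast
qed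

lemma character_mirror: "character x (mirror a b \<xi>) = character (mirror a b x) \<xi>"
  unfolding character_def mirror_def by (simp add: inner_vec_def sum_2)

text \<open>
  The action on frequencies that corresponds to axial symmetry about \<open>(1/2, 1/2)\<close>.
\<close>

definition reflect :: "bool \<Rightarrow> bool \<Rightarrow> int^2 \<Rightarrow> int^2"
  where "reflect a b k = vector [if a then 1 - k $ 1 else k $ 1, if b then 1 - k $ 2 else k $ 2]"

lemma reflect_reflect: "reflect a b (reflect a' b' k) = reflect (a \<noteq> a') (b \<noteq> b') k"
  by (simp add: reflect_def vec_eq_iff forall_2)

lemma reflect_involution [simp]: "reflect a b (reflect a b k) = k"
  by (simp add: reflect_def vec_eq_iff forall_2)

lemma character_reflect:
  assumes "c = vector [1/2, 1/2]"
  shows "character (c - mirror a b c) \<xi> * character (lat k) (mirror a b \<xi>) = character (lat (reflect a b k)) \<xi>"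
proof -
  have "lat (reflect a b k) = (c - mirror a b c) + mirror a b (lat k)"
    using assms by (simp add: reflect_def mirror_def vec_eq_iff forall_2)
  then show ?thesis by (simp only: character_add character_mirror)
qed

lemma bij_reflect:
  assumes "\<And>k. reflect a b k \<in> K \<longleftrightarrow> k \<in> K"
  shows "bij_betw (reflect a b) K K"
  by (rule bij_betwI[where g = "reflect a b"]) (use assms in auto)

text \<open>
  Averaging a representation of \<open>t\<close> over the symmetry group yields invariant coefficients.  In this
  way invariance of the coefficients follows without appealing to the linear independence of
  characters.
\<close>

lemma axial_symmetric_coefficients:
  assumes c: "c = vector [1/2, 1/2]" and t: "trig_poly t" "axial_symmetric c t"
  obtains K h where "finite K" "t = (\<lambda>\<xi>. \<Sum>k\<in>K. h k * character (lat k) \<xi>)"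
    "\<And>a b k. reflect a b k \<in> K \<longleftrightarrow> k \<in> K" "\<And>a b k. h (reflect a b k) = h k"
proof -
  obtain L g where L: "finite L" "t = (\<lambda>\<xi>. \<Sum>k\<in>L. g k * character (lat k) \<xi>)"
    using t(1) unfolding trig_poly_def by blast
  define g' where "g' k = (if k \<in> L then g k else 0)" for k
  \<comment> \<open>a finite set of frequencies that contains the support and is invariant under reflections\<close>
  define K where "K = (\<Union>a b. reflect a b ` L)"
  have fin: "finite K" using L(1) by (simp add: K_def)
  have LK: "L \<subseteq> K"
  proof
    fix k assume "k \<in> L"
    moreover have "k = reflect False False k" by (simp add: reflect_def vec_eq_iff forall_2)
    ultimately show "k \<in> K" unfolding K_def by blast
  qed
  have closed: "reflect a b k \<in> K" if "k \<in> K" for a b k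
  proof -
    from that obtain a' b' l where l: "l \<in> L" "k = reflect a' b' l" unfolding K_def by blast
    then have "reflect a b k = reflect (a \<noteq> a') (b \<noteq> b') l" by (simp only: reflect_reflect)
    with l(1) show ?thesis unfolding K_def by blast
  qed
  have K: "reflect a b k \<in> K \<longleftrightarrow> k \<in> K" for a b k
    using closed[of k a b] closed[of "reflect a b k" a b] by auto
  have t0: "t \<xi> = (\<Sum>k\<in>K. g' k * character (lat k) \<xi>)" for \<xi>
    unfolding L(2) g'_def by (rule sum.mono_neutral_cong_left[OF fin LK]) auto
  have tr: "t \<xi> = (\<Sum>k\<in>K. g' (reflect a b k) * character (lat k) \<xi>)" for a b \<xi>
  proof -
    have "t \<xi> = (\<Sum>k\<in>K. g' k * character (lat (reflect a b k)) \<xi>)"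
      unfolding axial_symmetric_mirror[OF t(2), of \<xi> a b] t0[of "mirror a b \<xi>"] sum_distrib_left
      by (intro sum.cong refl) (simp add: character_reflect[OF c, symmetric])
    also have "\<dots> = (\<Sum>k\<in>K. g' (reflect a b k) * character (lat k) \<xi>)"
      using sum.reindex_bij_betw[OF bij_reflect[of a b K, OF K],
          of "\<lambda>k. g' k * character (lat (reflect a b k)) \<xi>"] by simp
    finally show ?thesis .
  qed
  define h where "h k = (\<Sum>a\<in>UNIV. \<Sum>b\<in>UNIV. g' (reflect a b k)) / 4" for k
  show thesis
  proof (rule that[OF fin _ K])
    show "t = (\<lambda>\<xi>. \<Sum>k\<in>K. h k * character (lat k) \<xi>)"
    proof
      fix \<xi>
      have "t \<xi> = (\<Sum>a\<in>(UNIV :: bool set). \<Sum>b\<in>(UNIV :: bool set). t \<xi>) / 4"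
        by (simp add: UNIV_bool)
      also have "\<dots> = (\<Sum>a\<in>UNIV. \<Sum>b\<in>UNIV. \<Sum>k\<in>K. g' (reflect a b k) * character (lat k) \<xi>) / 4"
        by (simp only: tr[symmetric])
      also have "\<dots> = (\<Sum>k\<in>K. h k * character (lat k) \<xi>)"
        unfolding h_def UNIV_bool
        by (simp add: sum.distrib[symmetric] sum_divide_distrib distrib_right add_divide_distrib)
      finally show "t \<xi> = (\<Sum>k\<in>K. h k * character (lat k) \<xi>)" .
    qed
    show "h (reflect a b k) = h k" for a b k
      unfolding h_def reflect_reflect by (cases a; cases b) (simp_all add: UNIV_bool)
  qed
qed

text \<open>
  Reflections permute the cosets of \<open>\<gamma>1 \<int> \<times> \<gamma>2 \<int>\<close> and hence the coset parts of a symmetric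
  polynomial.  The target coset is named by an arbitrary representative \<open>e\<close>, because the chosen digits
  are mapped to each other only up to the lattice.
\<close>

lemma coset_part_mirror:
  assumes c: "c = vector [1/2, 1/2]"
    and K: "\<And>a b k. reflect a b k \<in> K \<longleftrightarrow> k \<in> K" and h: "\<And>a b k. h (reflect a b k) = h k"
    and M: "range ((*v) M) = {x. \<gamma>1 dvd x $ 1 \<and> \<gamma>2 dvd x $ 2}"
    and e: "\<gamma>1 dvd e $ 1 - reflect a b d $ 1" "\<gamma>2 dvd e $ 2 - reflect a b d $ 2"
  shows "character (c - mirror a b c) \<xi> * coset_part M K h d (mirror a b \<xi>) = coset_part M K h e \<xi>"
proof -
  have eq: "reflect a b k - e \<in> range ((*v) M) \<longleftrightarrow> k - d \<in> range ((*v) M)" for k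
  proof -
    have flip: "g dvd (if a then 1 - x else x) - y \<longleftrightarrow> g dvd x - z"
      if "g dvd y - (if a then 1 - z else z)" for g x y z :: int and a
    proof -
      have "g dvd (if a then 1 - x else x) - y \<longleftrightarrow>
          g dvd (if a then 1 - x else x) - (if a then 1 - z else z)"
        using that by (smt (verit) dvd_add dvd_diff)
      also have "\<dots> \<longleftrightarrow> g dvd x - z" by (auto simp: dvd_diff_commute)
      finally show ?thesis .
    qed
    show ?thesis
      using flip[of \<gamma>1 "e $ 1" a "d $ 1" "k $ 1"] flip[of \<gamma>2 "e $ 2" b "d $ 2" "k $ 2"] e
      by (simp add: M reflect_def)
  qed
  have bij: "bij_betw (reflect a b) {k \<in> K. k - d \<in> range ((*v) M)} {k \<in> K. k - e \<in> range ((*v) M)}"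
  proof (rule bij_betwI[where g = "reflect a b"])
    show "reflect a b \<in> {k \<in> K. k - e \<in> range ((*v) M)} \<rightarrow> {k \<in> K. k - d \<in> range ((*v) M)}"
      using K eq[of "reflect a b _"] by auto
  qed (use K eq in auto)
  have "character (c - mirror a b c) \<xi> * coset_part M K h d (mirror a b \<xi>) =
      (\<Sum>k | k \<in> K \<and> k - d \<in> range ((*v) M). h (reflect a b k) * character (lat (reflect a b k)) \<xi>)"
    unfolding coset_part_def sum_distrib_left
    by (intro sum.cong refl) (simp add: h character_reflect[OF c, symmetric])
  also have "\<dots> = coset_part M K h e \<xi>"
    unfolding coset_part_def by (rule sum.reindex_bij_betw[OF bij])
  finally show ?thesis .
qed

section \<open>Symmetric combinations of exponentials\<close>

definition residue_box :: "int \<Rightarrow> int \<Rightarrow> (int^2) set"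
  where "residue_box p q = {v. v $ 1 \<in> residues p \<and> v $ 2 \<in> residues q}"

lemma sum_residue_box:
  fixes f g :: "int \<Rightarrow> 'a::comm_semiring_0"
  shows "(\<Sum>v\<in>residue_box p q. f (v $ 1) * g (v $ 2)) = (\<Sum>x\<in>residues p. f x) * (\<Sum>y\<in>residues q. g y)"
proof -
  have "bij_betw (\<lambda>(x, y). vector [x, y]) (residues p \<times> residues q) (residue_box p q)"
    by (rule bij_betwI[where g = "\<lambda>v. (v $ 1, v $ 2)"])
      (auto simp: residue_box_def vec_eq_iff forall_2)
  from sum.reindex_bij_betw[OF this, of "\<lambda>v. f (v $ 1) * g (v $ 2)"] show ?thesis
    by (simp add: split_def sum_product sum.cartesian_product)
qed

definition residue_box_partner :: "int \<Rightarrow> int \<Rightarrow> bool \<Rightarrow> bool \<Rightarrow> int^2 \<Rightarrow> int^2"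
  where "residue_box_partner p q a b v =
    vector [if a then partner p (v $ 1) else v $ 1, if b then partner q (v $ 2) else v $ 2]"

text \<open>
  If the functions \<open>G\<close> are permuted by reflections like the residue pairs, then the tensor product
  of two butterfly rows combines the functions \<open>e\<^sub>v G\<^sub>v\<close> to an (anti)symmetric function.  A
  reflection replaces \<open>v\<close> by its partner, in the factor \<open>G\<^sub>v\<close> by assumption and in the character by
  the choice of the centre; reindexing the sum moves the partner to the butterfly
  coefficients, where it is worth a sign.
\<close>

lemma axial_antisymmetric_butterfly:
  fixes G :: "int^2 \<Rightarrow> real^2 \<Rightarrow> complex"
  assumes pq: "p > 0" "q > 0" and d: "d \<in> residue_box p q"
    and G: "\<And>a b v \<xi>. v \<in> residue_box p q \<Longrightarrow> G v (mirror a b \<xi>) = G (residue_box_partner p q a b v) \<xi>"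
  shows "axial_antisymmetric (vector [butterfly_center p (d $ 1), butterfly_center q (d $ 2)])
    (\<lambda>\<xi>. \<Sum>v\<in>residue_box p q. of_real (butterfly p (d $ 1) (v $ 1) * butterfly q (d $ 2) (v $ 2)) *
        (character (lat v) \<xi> * G v \<xi>))"
    (is "axial_antisymmetric ?c ?F")
proof -
  let ?U = "\<lambda>v :: int^2. butterfly p (d $ 1) (v $ 1) * butterfly q (d $ 2) (v $ 2)"
  let ?\<epsilon> = "\<lambda>a b. (if a then butterfly_sign (d $ 1) else 1) * (if b then butterfly_sign (d $ 2) else 1)"
  let ?P = "residue_box_partner p q"
  have bij: "bij_betw (?P a b) (residue_box p q) (residue_box p q)" for a b
    by (rule bij_betwI[where g = "?P a b"])
      (auto simp: residue_box_def residue_box_partner_def vec_eq_iff forall_2 partner_residues partner_partner)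
  have UP: "?U (?P a b v) = ?\<epsilon> a b * ?U v" if "v \<in> residue_box p q" for a b v
    using that d pq by (simp add: residue_box_def residue_box_partner_def butterfly_partner)
  have freq: "lat (?P a b v) = (?c - mirror a b ?c) + mirror a b (lat v)"
    if "v \<in> residue_box p q" "?U v \<noteq> 0" for a b v
    using that d butterfly_center[of "d $ 1" p "v $ 1"] butterfly_center[of "d $ 2" q "v $ 2"]
    by (simp add: residue_box_def residue_box_partner_def mirror_def vec_eq_iff forall_2)
  show ?thesis
  proof (rule axial_antisymmetric_mirrorI)
    show "?c \<in> half_lattice"
    proof -
      have "\<exists>k :: int. butterfly_center g x = of_int k / 2" for g x
        unfolding butterfly_center_def
        by (cases "2 * x = g + 1") (auto intro: exI[of _ "2 * x"] exI[of _ 1])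
      then obtain k l :: int where "butterfly_center p (d $ 1) = of_int k / 2"
        "butterfly_center q (d $ 2) = of_int l / 2" by metis
      then have "?c = (1 / 2) *\<^sub>R lat (vector [k, l])" by (simp add: vec_eq_iff forall_2)
      then show ?thesis unfolding half_lattice_def by blast
    qed
    show "complex_of_real (?\<epsilon> a b) \<in> {1, - 1}" for a b by (simp add: butterfly_sign_def)
    fix a b \<xi>
    have "?F \<xi> = (\<Sum>v\<in>residue_box p q. of_real (?U (?P a b v)) * (character (lat (?P a b v)) \<xi> * G (?P a b v) \<xi>))"
      by (rule sum.reindex_bij_betw[OF bij, symmetric])
    also have "\<dots> = (\<Sum>v\<in>residue_box p q. of_real (?\<epsilon> a b) * character (?c - mirror a b ?c) \<xi> *
        (of_real (?U v) * (character (lat v) (mirror a b \<xi>) * G v (mirror a b \<xi>))))"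
    proof (rule sum.cong[OF refl])
      fix v assume v: "v \<in> residue_box p q"
      show "of_real (?U (?P a b v)) * (character (lat (?P a b v)) \<xi> * G (?P a b v) \<xi>) =
          of_real (?\<epsilon> a b) * character (?c - mirror a b ?c) \<xi> *
            (of_real (?U v) * (character (lat v) (mirror a b \<xi>) * G v (mirror a b \<xi>)))"
      proof (cases "?U v = 0")
        case True
        then have "?U (?P a b v) = 0" unfolding UP[OF v] by simp
        with True show ?thesis by (simp only: of_real_0 mult_zero_left mult_zero_right)
      next
        case False
        show ?thesis
          unfolding UP[OF v] freq[OF v False] character_add character_mirror[symmetric] G[OF v] of_real_mult
          by (simp only: mult_ac)
      qed
    qed
    also have "\<dots> = of_real (?\<epsilon> a b) * character (?c - mirror a b ?c) \<xi> * ?F (mirror a b \<xi>)"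
      by (simp only: sum_distrib_left)
    finally show "?F \<xi> = of_real (?\<epsilon> a b) * character (?c - mirror a b ?c) \<xi> * ?F (mirror a b \<xi>)" .
  qed
qed

section \<open>The sum rule determines the moments of the coset parts\<close>

text \<open>
  The two shapes of \<open>M\<close> differ only in the order of the coordinates on the dual side, which is
  recorded by the indices \<open>i\<close> and \<open>j\<close>; both have the same lattice \<open>\<gamma>1 \<int> \<times> \<gamma>2 \<int>\<close>.
\<close>

lemma diagonal_or_antidiagonal:
  fixes M :: "int^2^2"
  assumes M: "M = vector [vector [\<gamma>1, 0], vector [0, \<gamma>2]] \<or> M = vector [vector [0, \<gamma>1], vector [\<gamma>2, 0]]"
    and nz: "\<gamma>1 \<noteq> 0" "\<gamma>2 \<noteq> 0"
  obtains i j :: 2 where "i = 1 \<and> j = 2 \<or> i = 2 \<and> j = 1"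
    "range ((*v) M) = {x. \<gamma>1 dvd x $ 1 \<and> \<gamma>2 dvd x $ 2}"
    "range ((*v) (transpose M)) = {x. \<gamma>1 dvd x $ i \<and> \<gamma>2 dvd x $ j}"
    "\<forall>y :: real^2. matrix_inv (map_matrix of_int (transpose M)) *v y =
      vector [y $ i / of_int \<gamma>1, y $ j / of_int \<gamma>2]"
proof -
  let ?A = "map_matrix of_int (transpose M) :: real^2^2"
  have inv: "matrix_inv ?A *v y = x" if "invertible ?A" "?A *v x = y" for x y
  proof -
    have "matrix_inv ?A ** ?A = mat 1"
      using someI_ex[of "\<lambda>B. ?A ** B = mat 1 \<and> B ** ?A = mat 1"] that(1)
      unfolding invertible_def matrix_inv_def by blast
    then have "matrix_inv ?A *v (?A *v x) = x"
      by (simp only: matrix_vector_mul_assoc matrix_vector_mul_lid)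
    with that(2) show ?thesis by simp
  qed
  from M show thesis
  proof
    assume M: "M = vector [vector [\<gamma>1, 0], vector [0, \<gamma>2]]"
    show thesis
    proof (rule that[of 1 2])
      show "range ((*v) M) = {x. \<gamma>1 dvd x $ 1 \<and> \<gamma>2 dvd x $ 2}"
      proof (intro set_eqI iffI)
        fix x :: "int^2" assume "x \<in> {x. \<gamma>1 dvd x $ 1 \<and> \<gamma>2 dvd x $ 2}"
        then have "x = M *v vector [x $ 1 div \<gamma>1, x $ 2 div \<gamma>2]"
          by (simp add: M vec_eq_iff forall_2 matrix_vector_mult_def sum_2)
        then show "x \<in> range ((*v) M)" by blast
      qed (auto simp: M matrix_vector_mult_def sum_2)
      have "transpose M = M" by (simp add: M vec_eq_iff forall_2 transpose_def)
      with \<open>range ((*v) M) = _\<close>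
      show "range ((*v) (transpose M)) = {x. \<gamma>1 dvd x $ 1 \<and> \<gamma>2 dvd x $ 2}" by simp
      have I: "invertible ?A" using nz by (simp add: invertible_det_nz det_2 M map_matrix_def transpose_def)
      show "\<forall>y. matrix_inv ?A *v y = vector [y $ 1 / of_int \<gamma>1, y $ 2 / of_int \<gamma>2]"
        by (rule allI, rule inv[OF I])
          (use nz in \<open>simp add: M vec_eq_iff forall_2 matrix_vector_mult_def sum_2
            map_matrix_def transpose_def\<close>)
    qed simp
  next
    assume M: "M = vector [vector [0, \<gamma>1], vector [\<gamma>2, 0]]"
    show thesis
    proof (rule that[of 2 1])
      show "range ((*v) M) = {x. \<gamma>1 dvd x $ 1 \<and> \<gamma>2 dvd x $ 2}"
      proof (intro set_eqI iffI)
        fix x :: "int^2" assume "x \<in> {x. \<gamma>1 dvd x $ 1 \<and> \<gamma>2 dvd x $ 2}"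
        then have "x = M *v vector [x $ 2 div \<gamma>2, x $ 1 div \<gamma>1]"
          by (simp add: M vec_eq_iff forall_2 matrix_vector_mult_def sum_2)
        then show "x \<in> range ((*v) M)" by blast
      qed (auto simp: M matrix_vector_mult_def sum_2)
      show "range ((*v) (transpose M)) = {x. \<gamma>1 dvd x $ 2 \<and> \<gamma>2 dvd x $ 1}"
      proof (intro set_eqI iffI)
        fix x :: "int^2" assume "x \<in> {x. \<gamma>1 dvd x $ 2 \<and> \<gamma>2 dvd x $ 1}"
        then have "x = transpose M *v vector [x $ 2 div \<gamma>1, x $ 1 div \<gamma>2]"
          by (simp add: M vec_eq_iff forall_2 matrix_vector_mult_def transpose_def sum_2
              del: transpose_matrix_vector)
        then show "x \<in> range ((*v) (transpose M))" by blast
      qed (auto simp: M matrix_vector_mult_def transpose_def sum_2 simp del: transpose_matrix_vector)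
      have I: "invertible ?A" using nz by (simp add: invertible_det_nz det_2 M map_matrix_def transpose_def)
      show "\<forall>y. matrix_inv ?A *v y = vector [y $ 2 / of_int \<gamma>1, y $ 1 / of_int \<gamma>2]"
        by (rule allI, rule inv[OF I])
          (use nz in \<open>simp add: M vec_eq_iff forall_2 matrix_vector_mult_def sum_2
            map_matrix_def transpose_def\<close>)
    qed simp
  qed
qed

lemma digit_set_residue_box:
  fixes N :: "int^2^2"
  assumes "range ((*v) N) = {x. p dvd x $ 1 \<and> q dvd x $ 2}" "p \<noteq> 0" "q \<noteq> 0"
  shows "digit_set N (residue_box \<bar>p\<bar> \<bar>q\<bar>)"
  unfolding digit_set_def
proof
  fix x :: "int^2"
  obtain y where y: "y \<in> residues \<bar>p\<bar>" "p dvd x $ 1 - y"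
    and uy: "\<And>y'. y' \<in> residues \<bar>p\<bar> \<Longrightarrow> p dvd x $ 1 - y' \<Longrightarrow> y' = y"
    using residues_ex1[of "\<bar>p\<bar>" "x $ 1"] assms(2) by auto
  obtain z where z: "z \<in> residues \<bar>q\<bar>" "q dvd x $ 2 - z"
    and uz: "\<And>z'. z' \<in> residues \<bar>q\<bar> \<Longrightarrow> q dvd x $ 2 - z' \<Longrightarrow> z' = z"
    using residues_ex1[of "\<bar>q\<bar>" "x $ 2"] assms(3) by auto
  show "\<exists>!d. d \<in> residue_box \<bar>p\<bar> \<bar>q\<bar> \<and> x - d \<in> range ((*v) N)"
  proof (rule ex1I[of _ "vector [y, z]"])
    show "vector [y, z] \<in> residue_box \<bar>p\<bar> \<bar>q\<bar> \<and> x - vector [y, z] \<in> range ((*v) N)"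
      using y z by (simp add: residue_box_def assms(1))
    fix d :: "int^2" assume "d \<in> residue_box \<bar>p\<bar> \<bar>q\<bar> \<and> x - d \<in> range ((*v) N)"
    then show "d = vector [y, z]" using uy uz by (simp add: residue_box_def assms(1) vec_eq_iff forall_2)
  qed
qed

lemma card_residue_box: "card (residue_box p q) = card (residues p) * card (residues q)"
  using sum_residue_box[of "\<lambda>_. 1 :: nat" "\<lambda>_. 1" p q] by simp

lemma character_dual_digit:
  assumes "\<And>y :: real^2. W *v y = vector [y $ i / of_int \<gamma>1, y $ j / of_int \<gamma>2]"
  shows "character (lat k) (W *v lat r) =
    exp (2 * of_real pi * \<i> * of_real (of_int (k $ 1 * r $ i) / of_int \<gamma>1 + of_int (k $ 2 * r $ j) / of_int \<gamma>2))"
  by (simp add: character_def assms inner_vec_def sum_2)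

lemma exp_2pi_int_iff: "exp (2 * of_real pi * \<i> * of_real x) = 1 \<longleftrightarrow> x \<in> \<int>"
proof -
  have "2 * of_int n * pi = 2 * pi * x \<longleftrightarrow> x = of_int n" for n by auto
  then show ?thesis by (auto simp: exp_eq_1 Ints_def mult_ac)
qed

lemma of_int_div_Ints_iff: "g \<noteq> 0 \<Longrightarrow> (of_int k / of_int g :: real) \<in> \<int> \<longleftrightarrow> g dvd k"
proof
  assume g: "g \<noteq> 0" and "(of_int k / of_int g :: real) \<in> \<int>"
  then obtain n where "of_int k / of_int g = (of_int n :: real)" by (auto elim: Ints_cases)
  with g have "(of_int k :: real) = of_int (g * n)" by (simp add: field_simps)
  then show "g dvd k" by (simp only: of_int_eq_iff) simp
qed (auto elim!: dvdE)

text \<open>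
  With \<open>N = M\<^sup>T\<close> and \<open>W\<close> its inverse, the points \<open>W r\<close> represent the dual lattice
  modulo \<open>\<int>\<^sup>2\<close>.  Summing a character over them tests whether its frequency is in \<open>M \<int>\<^sup>2\<close>.
\<close>

lemma dual_digit_sum:
  fixes W :: "real^2^2" and N :: "int^2^2"
  assumes ij: "i = 1 \<and> j = 2 \<or> i = 2 \<and> j = (1::2)" and nz: "\<gamma>1 \<noteq> 0" "\<gamma>2 \<noteq> 0"
    and N: "range ((*v) N) = {x. \<gamma>1 dvd x $ i \<and> \<gamma>2 dvd x $ j}"
    and W: "\<And>y :: real^2. W *v y = vector [y $ i / of_int \<gamma>1, y $ j / of_int \<gamma>2]"
    and D: "digit_set N D"
  shows "(\<Sum>r\<in>D. character (lat k) (W *v lat r)) =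
    (if \<gamma>1 dvd k $ 1 \<and> \<gamma>2 dvd k $ 2 then of_nat (card D) else 0)"
proof -
  let ?\<phi> = "\<lambda>r. character (lat k) (W *v lat r)"
  note \<phi> = character_dual_digit[OF W]
  have add: "?\<phi> (x + y) = ?\<phi> x * ?\<phi> y" for x y
    unfolding \<phi> by (simp add: exp_add[symmetric] distrib_left add_divide_distrib del: exp_add) (simp add: algebra_simps)
  have ints: "(of_int (a * b) / of_int g :: real) \<in> \<int>" if "g \<noteq> 0" "g dvd a \<or> g dvd b" for a b g
    using that of_int_div_Ints_iff[OF that(1), of "a * b"] by auto
  have ker: "?\<phi> x = 1" if "x \<in> range ((*v) N)" for x
    using that nz unfolding \<phi> exp_2pi_int_iff N by (intro Ints_add ints) auto
  have one: "(\<forall>z. ?\<phi> z = 1) \<longleftrightarrow> \<gamma>1 dvd k $ 1 \<and> \<gamma>2 dvd k $ 2"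
  proof
    assume all: "\<forall>z. ?\<phi> z = 1"
    have "i \<noteq> j" using ij by auto
    then have "(of_int (k $ 1) / of_int \<gamma>1 :: real) \<in> \<int>" "(of_int (k $ 2) / of_int \<gamma>2 :: real) \<in> \<int>"
      using all[THEN spec, of "axis i 1"] all[THEN spec, of "axis j 1"]
      unfolding \<phi> exp_2pi_int_iff by (simp_all add: axis_def)
    then show "\<gamma>1 dvd k $ 1 \<and> \<gamma>2 dvd k $ 2" by (simp add: of_int_div_Ints_iff nz)
  next
    assume "\<gamma>1 dvd k $ 1 \<and> \<gamma>2 dvd k $ 2"
    then show "\<forall>z. ?\<phi> z = 1" using nz unfolding \<phi> exp_2pi_int_iff by (auto intro!: Ints_add ints)
  qed
  have "(\<Sum>r\<in>D. ?\<phi> r) = (if \<forall>z. ?\<phi> z = 1 then of_nat (card D) else 0)"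
    by (rule digit_character_sum[OF D, of ?\<phi>]) (fact add, fact ker)
  then show ?thesis unfolding one .
qed

text \<open>
  The change of variables in the sum rule is a rescaling, possibly combined with a swap of
  coordinates; it changes the derivatives only by nonzero factors and by the order of the indices.
\<close>

lemma sum_rule_moments:
  fixes W :: "real^2^2"
  assumes ij: "i = 1 \<and> j = 2 \<or> i = 2 \<and> j = (1::2)" and nz: "\<gamma>1 \<noteq> 0" "\<gamma>2 \<noteq> 0"
    and W: "\<And>y :: real^2. matrix_inv (map_matrix of_int (transpose M)) *v y = 
      vector [y $ i / of_int \<gamma>1, y $ j / of_int \<gamma>2]"
    and t: "sum_rule M D n (\<lambda>\<xi>. \<Sum>k\<in>K. h k * character (lat k) \<xi>)"
    and r: "r \<in> D" "r \<noteq> 0" and ab: "a + b < n"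
  shows "(\<Sum>k\<in>K. h k * of_int (k $ 1) ^ a * of_int (k $ 2) ^ b *
    character (lat k) (matrix_inv (map_matrix of_int (transpose M)) *v lat r)) = 0"
proof -
  let ?W = "matrix_inv (map_matrix of_int (transpose M)) :: real^2^2"
  define x :: "int^2 \<Rightarrow> real^2" where
    "x k = (\<chi> l. if l = i then of_int (k $ 1) / of_int \<gamma>1 else of_int (k $ 2) / of_int \<gamma>2)" for k
  define \<beta> :: "nat^2" where "\<beta> = (\<chi> l. if l = i then a else b)"
  have chr: "character (lat k) (?W *v \<xi>) = character (x k) \<xi>" for k \<xi>
    using ij by (auto simp: character_def W x_def inner_vec_def sum_2 add.commute)
  have "\<beta> \<in> Delta n" using ij ab by (auto simp: \<beta>_def Delta_def)
  with t r have "multi_derivative \<beta> (\<lambda>\<xi>. \<Sum>k\<in>K. h k * character (lat k) (?W *v \<xi>)) (lat r) = 0"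
    unfolding sum_rule_def by blast
  then have "(\<Sum>k\<in>K. h k * of_real (x k $ 1) ^ (\<beta> $ 1) * of_real (x k $ 2) ^ (\<beta> $ 2) *
      character (lat k) (?W *v lat r)) = 0"
    unfolding chr multi_derivative_exponential_sum by simp
  also have "(\<Sum>k\<in>K. h k * of_real (x k $ 1) ^ (\<beta> $ 1) * of_real (x k $ 2) ^ (\<beta> $ 2) *
      character (lat k) (?W *v lat r)) =
    (\<Sum>k\<in>K. h k * of_int (k $ 1) ^ a * of_int (k $ 2) ^ b * character (lat k) (?W *v lat r))
      / (of_int \<gamma>1 ^ a * of_int \<gamma>2 ^ b)"
    unfolding sum_divide_distrib
    by (intro sum.cong refl) (use ij in \<open>auto simp: x_def \<beta>_def power_divide mult_ac\<close>)
  finally show ?thesis using nz by simp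
qed

text \<open>
  Fourier inversion on the level of moments.  Weight the moments of \<open>m0\<close> at the dual lattice points
  by conjugate characters of \<open>d\<close> and add them up.  Orthogonality leaves \<open>m\<close> times the moments of
  the coset part of \<open>d\<close>, while by the sum rule only the term of the origin survives.
\<close>

lemma coset_part_vanishing_moments:
  fixes M :: "int^2^2"
  assumes M: "M = vector [vector [\<gamma>1, 0], vector [0, \<gamma>2]] \<or> M = vector [vector [0, \<gamma>1], vector [\<gamma>2, 0]]"
    and nz: "\<gamma>1 \<noteq> 0" "\<gamma>2 \<noteq> 0" and s: "digit_enumeration M s"
    and D: "digit_set (transpose M) D" "0 \<in> D" and m: "index M > 0" and K: "finite K"
    and t: "sum_rule M D n (\<lambda>\<xi>. \<Sum>k\<in>K. h k * character (lat k) \<xi>)"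
  shows "vanishing_moments n (\<lambda>\<xi>. of_nat (index M) * coset_part M K h d \<xi> -
    (\<Sum>k\<in>K. h k * character (lat k) \<xi>))"
proof -
  obtain i j :: 2 where ij: "i = 1 \<and> j = 2 \<or> i = 2 \<and> j = 1"
    and R: "range ((*v) M) = {x. \<gamma>1 dvd x $ 1 \<and> \<gamma>2 dvd x $ 2}"
    and RT: "range ((*v) (transpose M)) = {x. \<gamma>1 dvd x $ i \<and> \<gamma>2 dvd x $ j}"
    and W': "\<forall>y :: real^2. matrix_inv (map_matrix of_int (transpose M)) *v y =
      vector [y $ i / of_int \<gamma>1, y $ j / of_int \<gamma>2]"
    by (rule diagonal_or_antidiagonal[OF M nz])
  note W = W'[rule_format]
  let ?W = "matrix_inv (map_matrix of_int (transpose M)) :: real^2^2"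
  \<comment> \<open>both numbers count the points of a box of residues; for antidiagonal \<open>M\<close> its sides are swapped\<close>
  have card: "card D = index M"
  proof -
    have "index M = card (s ` {..<index M})"
      using s unfolding digit_enumeration_def by (simp add: card_image)
    also have "\<dots> = card (residue_box \<bar>\<gamma>1\<bar> \<bar>\<gamma>2\<bar>)"
      using s digit_set_residue_box[OF R nz] unfolding digit_enumeration_def
      by (blast intro: bij_betw_same_card digit_rep_bij)
    also have "\<dots> = card D"
      using ij
    proof
      assume "i = 1 \<and> j = 2"
      then have "digit_set (transpose M) (residue_box \<bar>\<gamma>1\<bar> \<bar>\<gamma>2\<bar>)" using RT nz by (intro digit_set_residue_box) auto
      from bij_betw_same_card[OF digit_rep_bij[OF this D(1)]] show ?thesis .
    next
      assume "i = 2 \<and> j = 1"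
      then have "digit_set (transpose M) (residue_box \<bar>\<gamma>2\<bar> \<bar>\<gamma>1\<bar>)" using RT nz by (intro digit_set_residue_box) auto
      from bij_betw_same_card[OF digit_rep_bij[OF this D(1)]] show ?thesis
        by (simp add: card_residue_box mult.commute)
    qed
    finally show ?thesis ..
  qed
  with m have fin: "finite D" by (intro card_ge_0_finite) simp
  let ?g = "\<lambda>k. (if k - d \<in> range ((*v) M) then of_nat (index M) * h k else 0) - h k"
  have eq: "(\<lambda>\<xi>. of_nat (index M) * coset_part M K h d \<xi> - (\<Sum>k\<in>K. h k * character (lat k) \<xi>)) =
      (\<lambda>\<xi>. \<Sum>k\<in>K. ?g k * character (lat k) \<xi>)"
    unfolding coset_part_def sum.inter_filter[OF K] sum_distrib_left sum_subtractf[symmetric]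
    by (intro ext sum.cong refl) (auto simp: left_diff_distrib)
  show ?thesis
    unfolding eq vanishing_moments_iff
  proof (intro allI impI)
    fix a b assume ab: "a + b < n"
    let ?c = "\<lambda>k. h k * of_int (k $ 1) ^ a * of_int (k $ 2) ^ b"
    let ?S = "\<lambda>r. character (lat (- d)) (?W *v lat r) * (\<Sum>k\<in>K. ?c k * character (lat k) (?W *v lat r))"
    have "(\<Sum>k\<in>K. ?c k) = ?S 0"
    proof -
      have "lat 0 = 0" by (simp add: vec_eq_iff)
      then show ?thesis by simp
    qed
    also have "?S 0 = (\<Sum>r\<in>D. ?S r)"
      using sum_rule_moments[OF ij nz W t _ _ ab] D(2)
      by (subst sum.remove[OF fin D(2)]) (simp add: sum.neutral)
    also have "\<dots> = (\<Sum>k\<in>K. ?c k * (\<Sum>r\<in>D. character (lat (k - d)) (?W *v lat r)))"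
    proof -
      have "lat (k - d) = lat (- d) + lat k" for k by (simp add: vec_eq_iff)
      then show ?thesis
        unfolding sum_distrib_left by (subst sum.swap) (simp only: character_add mult_ac)
    qed
    also have "\<dots> = (\<Sum>k\<in>K. if k - d \<in> range ((*v) M) then of_nat (index M) * ?c k else 0)"
      unfolding dual_digit_sum[OF ij nz RT W D(1)] by (intro sum.cong refl) (simp add: R card)
    finally have *: "(\<Sum>k\<in>K. (if k - d \<in> range ((*v) M) then of_nat (index M) * ?c k else 0) - ?c k) = 0"
      by (simp add: sum_subtractf)
    show "(\<Sum>k\<in>K. ?g k * of_real (lat k $ 1) ^ a * of_real (lat k $ 2) ^ b) = 0"
      by (rule trans[OF _ *]) (intro sum.cong refl, auto simp: left_diff_distrib)
  qed
qed

section \<open>Existence of symmetric wavelet masks\<close>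

theorem theorem28:
  fixes M :: "int^2^2" and \<gamma>1 \<gamma>2 :: int and n :: nat
    and s :: "nat \<Rightarrow> int^2" and D :: "(int^2) set"
    and m0 m0' :: "real^2 \<Rightarrow> complex" and c :: "real^2"
  assumes "matrix_dilation M"
    and "M = vector [vector [\<gamma>1, 0], vector [0, \<gamma>2]] \<or>
         M = vector [vector [0, \<gamma>1], vector [\<gamma>2, 0]]"
    and "digit_enumeration M s"
    and "digit_set (transpose M) D" and "0 \<in> D"
    and "n \<ge> 1"
    and "c = vector [1/2, 1/2]"
    and "refinable_mask m0" and "refinable_mask m0'"
    and "axial_symmetric c m0" and "axial_symmetric c m0'"
    and "sum_rule M D n m0"
    and "\<forall>\<beta> \<in> Delta n. multi_derivative \<beta> (\<lambda>\<xi>. 1 - m0 \<xi> * cnj (m0' \<xi>)) 0 = 0"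
  shows "\<exists>f f'. f 0 = m0 \<and> f' 0 = m0' \<and> wavelet_masks M s f f' \<and>
    (\<forall>\<nu> \<in> {1..index M}.
      (\<exists>a. axial_symmetric a (f \<nu>) \<or> axial_antisymmetric a (f \<nu>)) \<and>
      (\<exists>a. axial_symmetric a (f' \<nu>) \<or> axial_antisymmetric a (f' \<nu>)) \<and>
      vanishing_moments n (f' \<nu>))"
proof -
  note M = assms(2) and s = assms(3) and c = assms(7)
  have m: "index M > 0"
  proof (rule ccontr)
    assume "\<not> index M > 0"
    with s have "digit_set M {}" unfolding digit_enumeration_def by simp
    then show False unfolding digit_set_def by blast
  qed
  then have "det M \<noteq> 0" by (auto simp: index_def)
  with M have nz: "\<gamma>1 \<noteq> 0" "\<gamma>2 \<noteq> 0" by (auto simp: det_2)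
  obtain i j :: 2 where R: "range ((*v) M) = {x. \<gamma>1 dvd x $ 1 \<and> \<gamma>2 dvd x $ 2}"
    by (rule diagonal_or_antidiagonal[OF M nz])
  have trig: "trig_poly m0" "trig_poly m0'"
    using assms(8,9) unfolding refinable_mask_def by auto
  obtain K h where K: "finite K" and m0: "m0 = (\<lambda>\<xi>. \<Sum>k\<in>K. h k * character (lat k) \<xi>)"
    and Ksym: "\<And>a b k. reflect a b k \<in> K \<longleftrightarrow> k \<in> K" and hsym: "\<And>a b k. h (reflect a b k) = h k"
    by (rule axial_symmetric_coefficients[OF c trig(1) assms(10)]) blast
  obtain K' h' where K': "finite K'" "m0' = (\<lambda>\<xi>. \<Sum>k\<in>K'. h' k * character (lat k) \<xi>)"
    using trig(2) unfolding trig_poly_def by blast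

  let ?p = "\<bar>\<gamma>1\<bar>" and ?q = "\<bar>\<gamma>2\<bar>"
  let ?B = "residue_box ?p ?q"
  have B: "digit_set M ?B" by (rule digit_set_residue_box[OF R nz])
  \<comment> \<open>the given digits, moved within their cosets to the box on which reflections act by pairing\<close>
  define d where "d = digit_rep M ?B \<circ> s"
  have d_bij: "bij_betw d {..<index M} ?B"
  proof -
    have "bij_betw s {..<index M} (s ` {..<index M})"
      using s unfolding digit_enumeration_def by (intro inj_on_imp_bij_betw) blast
    moreover have "bij_betw (digit_rep M ?B) (s ` {..<index M}) ?B"
      using s B unfolding digit_enumeration_def by (intro digit_rep_bij) blast+
    ultimately show ?thesis unfolding d_def by (rule bij_betw_trans)
  qed
  have d: "digit_enumeration M d"
    using d_bij B unfolding digit_enumeration_def bij_betw_def by simp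
  have ds: "d k - s k \<in> range ((*v) M)" for k
    unfolding d_def o_def by (rule range_mult_vec_minus[OF digit_rep(2)[OF B]])

  let ?r = "complex_of_real (sqrt (real (index M)))"
  have r: "?r \<noteq> 0" using m by simp
  have r2: "?r * ?r = of_nat (index M)" by (simp flip: of_real_mult)
  let ?U = "\<lambda>u v :: int^2. butterfly ?p (u $ 1) (v $ 1) * butterfly ?q (u $ 2) (v $ 2)"
  have orth: "(\<Sum>i<index M. ?U (d i) (d j) * ?U (d i) (d k)) = (if j = k then 1 else 0)"
    if "j < index M" "k < index M" for j k
  proof -
    have in_B: "d j \<in> ?B" "d k \<in> ?B" using d_bij that by (auto simp: bij_betw_def)
    have "(\<Sum>i<index M. ?U (d i) (d j) * ?U (d i) (d k)) = (\<Sum>v\<in>?B. ?U v (d j) * ?U v (d k))"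
      by (rule sum.reindex_bij_betw[OF d_bij])
    also have "\<dots> = (\<Sum>v\<in>?B. (butterfly ?p (v $ 1) (d j $ 1) * butterfly ?p (v $ 1) (d k $ 1)) *
        (butterfly ?q (v $ 2) (d j $ 2) * butterfly ?q (v $ 2) (d k $ 2)))"
      by (simp only: mult_ac)
    also have "\<dots> = (\<Sum>x\<in>residues ?p. butterfly ?p x (d j $ 1) * butterfly ?p x (d k $ 1)) *
        (\<Sum>y\<in>residues ?q. butterfly ?q y (d j $ 2) * butterfly ?q y (d k $ 2))"
      by (rule sum_residue_box)
    also have "\<dots> = (if d j = d k then 1 else 0)"
      using in_B by (auto simp: residue_box_def butterfly_orthogonal vec_eq_iff forall_2)
    also have "\<dots> = (if j = k then 1 else 0)"
      using d_bij that by (auto simp: bij_betw_def inj_on_def)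
    finally show ?thesis .
  qed

  obtain \<mu> where \<mu>: "polyphase_components M d m0 \<mu>"
    and part: "\<And>i \<xi>. character (lat (d i)) \<xi> * \<mu> i (map_matrix of_int (transpose M) *v \<xi>) =
      ?r * coset_part M K h (d i) \<xi>"
    unfolding m0 by (rule polyphase_components_exist[OF d K m, where h = h]) blast
  obtain \<mu>' where \<mu>': "polyphase_components M d m0' \<mu>'"
    unfolding K'(2) by (rule polyphase_components_exist[OF d K'(1) m, where h = h'])
  \<comment> \<open>the wavelet masks before the orthogonal mixing are \<open>e\<^sub>v g\<^sub>v\<close> and \<open>e\<^sub>v g'\<^sub>v\<close>\<close>
  define g :: "int^2 \<Rightarrow> real^2 \<Rightarrow> complex" where "g v \<xi> = 1 / ?r" for v \<xi>
  define g' where "g' v \<xi> = (1 - of_nat (index M) * cnj (coset_part M K h v \<xi>) * m0' \<xi>) / ?r" for v \<xi>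
  define w where "w G u \<xi> = (\<Sum>v\<in>?B. of_real (?U u v) * (character (lat v) \<xi> * G v \<xi>))"
    for G :: "int^2 \<Rightarrow> real^2 \<Rightarrow> complex" and u :: "int^2" and \<xi>
  have w: "(\<Sum>k<index M. of_real (?U u (d k)) * (character (lat (d k)) \<xi> * G (d k) \<xi>)) = w G u \<xi>"
    for G u \<xi>
    unfolding w_def by (rule sum.reindex_bij_betw[OF d_bij])
  define f where "f = case_nat m0 (\<lambda>i. w g (d i))"
  define f' where "f' = case_nat m0' (\<lambda>i. w g' (d i))"
  have "wavelet_masks M d f f'"
  proof -
    have "character (lat (d k)) \<xi> / ?r - cnj (\<mu> k (map_matrix of_int (transpose M) *v \<xi>)) * m0' \<xi> =
        character (lat (d k)) \<xi> * g' (d k) \<xi>" for k \<xi>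
    proof -
      let ?e = "character (lat (d k)) \<xi>"
      have "cnj (\<mu> k (map_matrix of_int (transpose M) *v \<xi>)) =
          ?e * cnj (?e * \<mu> k (map_matrix of_int (transpose M) *v \<xi>))"
        using character_mult_cnj[of "lat (d k)" \<xi>] by (simp flip: mult.assoc)
      also have "\<dots> = ?e * (?r * cnj (coset_part M K h (d k) \<xi>))"
        unfolding part by simp
      finally show ?thesis
        unfolding g'_def r2[symmetric] using r by (simp add: field_simps)
    qed
    moreover have "character (lat (d k)) \<xi> / ?r = character (lat (d k)) \<xi> * g (d k) \<xi>" for k \<xi>
      by (simp add: g_def)
    ultimately show ?thesis
      using mixed_extension[OF m \<mu> \<mu>' orth] unfolding f_def f'_def by (simp only: w)
  qed
  then have masks: "wavelet_masks M s f f'"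
    by (rule wavelet_masks_change_digits) (rule ds)

  have w_symmetry: "\<exists>a. axial_antisymmetric a (w G u)"
    if "u \<in> ?B" "\<And>a b v \<xi>. v \<in> ?B \<Longrightarrow> G v (mirror a b \<xi>) = G (residue_box_partner ?p ?q a b v) \<xi>"
    for G u
    using axial_antisymmetric_butterfly[of ?p ?q u G] that nz unfolding w_def[abs_def] by auto
  have g'_mirror: "g' v (mirror a b \<xi>) = g' (residue_box_partner ?p ?q a b v) \<xi>" for a b v \<xi>
  proof -
    let ?P = "residue_box_partner ?p ?q a b v" and ?e = "character (c - mirror a b c) \<xi>"
    have "?p dvd ?P $ 1 - reflect a b v $ 1" "?q dvd ?P $ 2 - reflect a b v $ 2"
      by (auto simp only: residue_box_partner_def reflect_def vector_2 partner_dvd diff_self dvd_0_right split: if_split)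
    then have P: "?e * coset_part M K h v (mirror a b \<xi>) = coset_part M K h ?P \<xi>"
      by (intro coset_part_mirror[where K = K and h = h, OF c Ksym hsym R]) simp_all
    have "cnj (coset_part M K h ?P \<xi>) * m0' \<xi> =
        (?e * cnj ?e) * (cnj (coset_part M K h v (mirror a b \<xi>)) * m0' (mirror a b \<xi>))"
      unfolding P[symmetric] axial_symmetric_mirror[OF assms(11), of \<xi> a b] by (simp add: mult_ac)
    then show ?thesis unfolding g'_def by (simp add: character_mult_cnj mult.assoc)
  qed

  have trig_g': "trig_poly (g' v)" for v
    unfolding g'_def[abs_def] divide_inverse
    by (intro trig_poly_intros trig_poly_coset_part trig)
  have van_g': "vanishing_moments n (g' v)" for v
  proof -
    let ?a = "\<lambda>\<xi>. cnj (1 - m0 \<xi> * cnj (m0' \<xi>))"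
    let ?b = "\<lambda>\<xi>. cnj (of_nat (index M) * coset_part M K h v \<xi> - m0 \<xi>)"
    have tr: "trig_poly (\<lambda>\<xi>. 1 - m0 \<xi> * cnj (m0' \<xi>))"
      "trig_poly (\<lambda>\<xi>. of_nat (index M) * coset_part M K h v \<xi> - m0 \<xi>)"
      by (intro trig_poly_intros trig trig_poly_coset_part)+
    have "vanishing_moments n (\<lambda>\<xi>. 1 - m0 \<xi> * cnj (m0' \<xi>))"
      using assms(13) unfolding vanishing_moments_def by simp
    then have a: "vanishing_moments n ?a" by (rule vanishing_moments_cnj[OF tr(1)])
    have "vanishing_moments n (\<lambda>\<xi>. of_nat (index M) * coset_part M K h v \<xi> - m0 \<xi>)"
      unfolding m0
      by (rule coset_part_vanishing_moments[OF M nz s assms(4,5) m K assms(12)[unfolded m0]])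
    then have b: "vanishing_moments n ?b" by (rule vanishing_moments_cnj[OF tr(2)])
    \<comment> \<open>telescope: first \<open>m0\<close> replaces \<open>m p\<^sub>v\<close>, then the product condition at the origin applies\<close>
    have "vanishing_moments n (\<lambda>\<xi>. ?a \<xi> * (1 / ?r) + ?b \<xi> * (- 1 / ?r * m0' \<xi>))"
      by (intro vanishing_moments_add vanishing_moments_mult a b trig_poly_intros trig trig_poly_coset_part)
    also have "(\<lambda>\<xi>. ?a \<xi> * (1 / ?r) + ?b \<xi> * (- 1 / ?r * m0' \<xi>)) = g' v"
      unfolding g'_def[abs_def] using r by (intro ext) (simp add: field_simps)
    finally show ?thesis .
  qed
  have van: "vanishing_moments n (w g' u)" for u
    unfolding w_def[abs_def]
  proof (rule vanishing_moments_sum)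
    fix v
    have eq: "of_real (?U u v) * (character (lat v) \<xi> * g' v \<xi>) =
        g' v \<xi> * (of_real (?U u v) * character (lat v) \<xi>)" for \<xi> by (simp only: mult_ac)
    show "trig_poly (\<lambda>\<xi>. of_real (?U u v) * (character (lat v) \<xi> * g' v \<xi>))"
      by (intro trig_poly_mult trig_poly_const trig_poly_character trig_g')
    show "vanishing_moments n (\<lambda>\<xi>. of_real (?U u v) * (character (lat v) \<xi> * g' v \<xi>))"
      unfolding eq by (intro vanishing_moments_mult trig_g' van_g' trig_poly_monomial)
  qed

  show ?thesis
  proof (rule exI[of _ f], rule exI[of _ f'], intro conjI ballI masks)
    fix \<nu> assume "\<nu> \<in> {1..index M}"
    then obtain i where i: "\<nu> = Suc i" "i < index M" by (cases \<nu>) auto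
    then have u: "d i \<in> ?B" using d_bij by (auto simp: bij_betw_def)
    have "\<exists>a. axial_antisymmetric a (f \<nu>)"
      unfolding f_def i(1) nat.case by (rule w_symmetry[OF u]) (simp add: g_def)
    then show "\<exists>a. axial_symmetric a (f \<nu>) \<or> axial_antisymmetric a (f \<nu>)" by blast
    have "\<exists>a. axial_antisymmetric a (f' \<nu>)"
      unfolding f'_def i(1) nat.case by (rule w_symmetry[of "d i" g', OF u g'_mirror])
    then show "\<exists>a. axial_symmetric a (f' \<nu>) \<or> axial_antisymmetric a (f' \<nu>)" by blast
    show "vanishing_moments n (f' \<nu>)"
      unfolding f'_def i(1) nat.case by (rule van)
  qed (simp_all add: f_def f'_def)
qed

end
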